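(* Let $K$ be a compact hyperbolic attractor of the flow $f^t$ of a smooth vector field $F$ with $F\ne0$ on $K$, let $\mathcal{O}=\{x_t\}_{t\in\mathbb{R}}$, $x_t=f^t(x_0)$, be an orbit on $K$, and let $(\omega,\psi)\in\mathcal{A}(\mathcal{O})$. For $\nu\in\mathcal{X}^*(\mathcal{O})$, the following characterizations satisfy (c) $\Leftrightarrow$ (b) $\Rightarrow$ (a). (a) For any $X\in\mathcal{X}(\mathcal{O})$, $$\lim_{T\to\infty}\left(\langle\!\langle S(X);\omega,\psi\rangle\!\rangle_{\mathcal{O},T}-\frac1{2T}\int_{-T}^TX\nu\,dt\right)=0 ,$$ where the product at finite $T$ is evaluated on any representative $(v,\eta)$ of $S(X)$. (b) $\nu$ has the expansion formula $$\nu=\int_{t\ge0}f^{*t}\omega^s_t\,dt-\int_{t\le0}f^{*t}\omega^u_t\,dt-\psi\,\varepsilon^c ,$$ that is, $\nu_\tau=\int_{t\ge\tau}f^{*(t-\tau)}\omega^s_t\,dt-\int_{t\le\tau}f^{*(t-\tau)}\omega^u_t\,dt-\psi_\tau\varepsilon^c_\tau$ for all $\tau\in\mathbb{R}$. (c) $\nu$ is the unique bounded solution of the inhomogeneous adjoint equation $$\nabla_F\nu-\nabla_\nu F=\mathcal{L}_F\nu=-\omega\ \text{ on }\mathcal{O},\qquad\nu_\tau(F_\tau)=-\psi_\tau ,$$ where the last condition may equivalently be imposed for all $\tau\in\mathbb{R}$ or for any single $\tau$.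
   Context: Setting. $\mathcal{M}$ is a smooth Riemannian manifold and $f^t$ is the flow of a smooth vector field $F$. $K$ is a compact hyperbolic attractor with $F\neq0$ on $K$: there is a continuous $f_*$-invariant splitting $T_K\mathcal{M}=V^s\oplus V^u\oplus V^c$, $V^c=\mathrm{span}(F)$, and constants $C>0$, $0<\lambda<1$ with $|f_*^{-t}|_{V^u}|,|f_*^t|_{V^s}|\le C\lambda^t$ for $t\ge0$; and there is an open neighborhood $U$ of $K$ with $\bigcap_{t\ge0}f^tU=K$. Notation. $P^s,P^u,P^c$ are the projections of the splitting. The pullback $f^{*t}$ is the adjoint of $f^t_*$, taking covectors at $f^tx$ to covectors at $x$ ($t\in\mathbb{R}$). $\omega^s,\omega^u$ are the covectors $\omega\circ P^s$, $\omega\circ P^u$. $\varepsilon^c$ is the covector field vanishing on $V^s\oplus V^u$ with $\varepsilon^c(F)=1$. $(\cdot)_t$ denotes the value at $x_t$. For a vector $X$ and covector $\omega$, $X\omega=\omega X:=\omega(X)$. $\mathcal{L}$ is the Lie derivative, $\nabla$ the Riemannian derivative (along $\mathcal{O}$, $\nabla_F$ is the covariant derivative in $t$), and for a covector $\nu$, $\nabla_\nu F:=\nabla_F\nu-\mathcal{L}_F\nu$, equivalently $(\nabla_\nu F)(Y)=-\nu(\nabla_YF)$. $F(\psi)$ is the derivative of $\psi$ along $F$. Spaces on the orbit. $\mathcal{O}$ carries the topology of $\mathbb{R}$ (points at different times are counted as distinct). $\mathcal{X}(\mathcal{O})$, $\mathcal{X}^*(\mathcal{O})$, $C(\mathcal{O})$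 are the bounded continuous vector fields, covector fields and functions along $\mathcal{O}$; $\mathcal{X}^1(\mathcal{O})$ the bounded vector fields continuously differentiable along $\mathcal{O}$; $C^1(\mathcal{O})$ the bounded functions continuously differentiable along $\mathcal{O}$. $A(\mathcal{O}):=\{(v,\eta):v\in\mathcal{X}^1(\mathcal{O}),\eta\in C(\mathcal{O})\}/\sim$, where $(v_1,\eta_1)\sim(v_2,\eta_2)$ iff $\mathcal{L}_Fv_1+\eta_1F=\mathcal{L}_Fv_2+\eta_2F$. $\mathcal{A}(\mathcal{O}):=\{(\omega,\psi):\omega\in\mathcal{X}^*(\mathcal{O}),\psi\in C^1(\mathcal{O}),F(\psi)=\omega(F)\}$. The tangent shadowing operator $S:\mathcal{X}(\mathcal{O})\to A(\mathcal{O})$ is $S(X)=[v,\eta]$ where $\mathcal{L}_Fv+\eta F=X$. The product is $\langle\!\langle[v,\eta];\omega,\psi\rangle\!\rangle_{\mathcal{O},T}:=\frac1{2T}\int_{-T}^T(\omega v-\eta\psi)\,dt$. *)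

theory Defs
  imports "HOL-Analysis.Analysis"
begin

section \<open>Smooth manifolds\<close>

text \<open>
  A manifold is a Hausdorff, second countable type \<open>'m\<close> with a smooth atlas \<open>A\<close>, whose charts are
  pairs (domain, coordinate map) with values in a Euclidean space \<open>'e\<close>.
\<close>

primrec Ck_on :: "nat \<Rightarrow> 'a::real_normed_vector set \<Rightarrow> ('a \<Rightarrow> 'b::real_normed_vector) \<Rightarrow> bool" where
  "Ck_on 0 S f \<longleftrightarrow> continuous_on S f"
| "Ck_on (Suc k) S f \<longleftrightarrow>
     (\<forall>y\<in>S. f differentiable (at y)) \<and> (\<forall>u. Ck_on k S (\<lambda>y. frechet_derivative f (at y) u))"

text \<open>Only meaningful for open \<open>S\<close> (all derivatives are two-sided).\<close>
definition smooth_on :: "'a::real_normed_vector set \<Rightarrow> ('a \<Rightarrow> 'b::real_normed_vector) \<Rightarrow> bool" where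
  "smooth_on S f \<longleftrightarrow> (\<forall>k. Ck_on k S f)"

type_synonym ('m, 'e) chart = "'m set \<times> ('m \<Rightarrow> 'e)"

abbreviation cdom :: "('m, 'e) chart \<Rightarrow> 'm set" where "cdom c \<equiv> fst c"
abbreviation cmap :: "('m, 'e) chart \<Rightarrow> 'm \<Rightarrow> 'e" where "cmap c \<equiv> snd c"

definition cinv :: "('m, 'e) chart \<Rightarrow> 'e \<Rightarrow> 'm" where
  "cinv c = inv_into (cdom c) (cmap c)"

definition is_chart :: "('m::topological_space, 'e::euclidean_space) chart \<Rightarrow> bool" where
  "is_chart c \<longleftrightarrow> open (cdom c) \<and> inj_on (cmap c) (cdom c) \<and> open (cmap c ` cdom c) \<and>
     homeomorphism (cdom c) (cmap c ` cdom c) (cmap c) (cinv c)"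

definition smooth_atlas ::
  "('m::{t2_space,second_countable_topology}, 'e::euclidean_space) chart set \<Rightarrow> bool" where
  "smooth_atlas A \<longleftrightarrow>
     (\<forall>c\<in>A. is_chart c) \<and> (\<Union>c\<in>A. cdom c) = UNIV \<and>
     (\<forall>c\<in>A. \<forall>d\<in>A. smooth_on (cmap c ` (cdom c \<inter> cdom d)) (cmap d \<circ> cinv c))"

text \<open>
  A preferred chart is chosen at every point, and \<open>T\<^sub>p M\<close> is identified with \<open>'e\<close> through the
  components in the preferred chart at \<open>p\<close>; covectors at \<open>p\<close> are thus elements of \<open>'e \<Rightarrow>\<^sub>L real\<close>.
  The preferred chart need not depend continuously on \<open>p\<close>, so regularity of vector and covector
  fields has to be expressed by passing to the components in a fixed chart: \<open>to_chart A c p\<close> sends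
  a tangent vector at \<open>p\<close> to its components in \<open>c\<close>, and \<open>of_chart A c p\<close> is the inverse map.
\<close>

definition chart_at :: "('m, 'e) chart set \<Rightarrow> 'm \<Rightarrow> ('m, 'e) chart" where
  "chart_at A p = (SOME c. c \<in> A \<and> p \<in> cdom c)"

definition to_chart ::
  "('m, 'e::euclidean_space) chart set \<Rightarrow> ('m, 'e) chart \<Rightarrow> 'm \<Rightarrow> 'e \<Rightarrow>\<^sub>L 'e" where
  "to_chart A c p =
     Blinfun (frechet_derivative (cmap c \<circ> cinv (chart_at A p)) (at (cmap (chart_at A p) p)))"

definition of_chart ::
  "('m, 'e::euclidean_space) chart set \<Rightarrow> ('m, 'e) chart \<Rightarrow> 'm \<Rightarrow> 'e \<Rightarrow>\<^sub>L 'e" where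
  "of_chart A c p =
     Blinfun (frechet_derivative (cmap (chart_at A p) \<circ> cinv c) (at (cmap c p)))"

text \<open>The tangent map \<open>T\<^sub>p M \<rightarrow> T\<^bsub>h p\<^esub> M\<close> of \<open>h\<close> and its adjoint.\<close>

definition pushforward ::
  "('m, 'e::euclidean_space) chart set \<Rightarrow> ('m \<Rightarrow> 'm) \<Rightarrow> 'm \<Rightarrow> 'e \<Rightarrow>\<^sub>L 'e" where
  "pushforward A h p =
     Blinfun (frechet_derivative (cmap (chart_at A (h p)) \<circ> h \<circ> cinv (chart_at A p))
       (at (cmap (chart_at A p) p)))"

definition pullback ::
  "('m, 'e::euclidean_space) chart set \<Rightarrow> ('m \<Rightarrow> 'm) \<Rightarrow> 'm \<Rightarrow> ('e \<Rightarrow>\<^sub>L real) \<Rightarrow> ('e \<Rightarrow>\<^sub>L real)" where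
  "pullback A h p \<omega> = \<omega> o\<^sub>L pushforward A h p"

definition smooth_vector_field ::
  "('m, 'e::euclidean_space) chart set \<Rightarrow> ('m \<Rightarrow> 'e) \<Rightarrow> bool" where
  "smooth_vector_field A F \<longleftrightarrow>
     (\<forall>c\<in>A. smooth_on (cmap c ` cdom c) (\<lambda>y. to_chart A c (cinv c y) (F (cinv c y))))"

text \<open>\<open>f t p\<close> is \<open>f\<^sup>t(p)\<close>: a smooth action of the reals whose infinitesimal generator is \<open>F\<close>.\<close>

definition flow_of ::
  "('m::topological_space, 'e::euclidean_space) chart set \<Rightarrow> ('m \<Rightarrow> 'e) \<Rightarrow> (real \<Rightarrow> 'm \<Rightarrow> 'm) \<Rightarrow> bool" where
  "flow_of A F f \<longleftrightarrow>
     (\<forall>p. f 0 p = p) \<and> (\<forall>s t p. f (s + t) p = f s (f t p)) \<and>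
     continuous_on UNIV (\<lambda>(t, p). f t p) \<and>
     (\<forall>c\<in>A. \<forall>d\<in>A. smooth_on {(t, y). y \<in> cmap c ` cdom c \<and> f t (cinv c y) \<in> cdom d}
        (\<lambda>(t, y). cmap d (f t (cinv c y)))) \<and>
     (\<forall>t p. ((\<lambda>s. cmap (chart_at A (f t p)) (f s p)) has_vector_derivative F (f t p)) (at t))"


section \<open>Riemannian metrics\<close>

definition metric_in_chart ::
  "('m, 'e::euclidean_space) chart set \<Rightarrow> ('m \<Rightarrow> 'e \<Rightarrow> 'e \<Rightarrow> real) \<Rightarrow> ('m, 'e) chart
    \<Rightarrow> 'e \<Rightarrow> 'e \<Rightarrow> 'e \<Rightarrow> real" where
  "metric_in_chart A g c y u w =
     g (cinv c y) (of_chart A c (cinv c y) u) (of_chart A c (cinv c y) w)"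

definition riemannian_metric ::
  "('m, 'e::euclidean_space) chart set \<Rightarrow> ('m \<Rightarrow> 'e \<Rightarrow> 'e \<Rightarrow> real) \<Rightarrow> bool" where
  "riemannian_metric A g \<longleftrightarrow>
     (\<forall>p. bilinear (g p) \<and> (\<forall>u w. g p u w = g p w u) \<and> (\<forall>u. u \<noteq> 0 \<longrightarrow> g p u u > 0)) \<and>
     (\<forall>c\<in>A. \<forall>u w. smooth_on (cmap c ` cdom c) (\<lambda>y. metric_in_chart A g c y u w))"

definition riemannian_manifold ::
  "('m::{t2_space,second_countable_topology}, 'e::euclidean_space) chart set
    \<Rightarrow> ('m \<Rightarrow> 'e \<Rightarrow> 'e \<Rightarrow> real) \<Rightarrow> bool" where
  "riemannian_manifold A g \<longleftrightarrow> smooth_atlas A \<and> riemannian_metric A g"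

definition rnorm :: "('m \<Rightarrow> 'e \<Rightarrow> 'e \<Rightarrow> real) \<Rightarrow> 'm \<Rightarrow> 'e \<Rightarrow> real" where
  "rnorm g p u = sqrt (g p u u)"

text \<open>
  Christoffel symbols of the Levi-Civita connection as a bilinear map of components, by the Koszul
  formula for constant coefficient fields in the chart.
\<close>

definition christoffel ::
  "('m, 'e::euclidean_space) chart set \<Rightarrow> ('m \<Rightarrow> 'e \<Rightarrow> 'e \<Rightarrow> real) \<Rightarrow> ('m, 'e) chart
    \<Rightarrow> 'e \<Rightarrow> 'e \<Rightarrow> 'e \<Rightarrow> 'e" where
  "christoffel A g c y u w =
     (let G = metric_in_chart A g c in
      THE e. \<forall>z. G y e z =
        (frechet_derivative (\<lambda>y'. G y' w z) (at y) u
         + frechet_derivative (\<lambda>y'. G y' u z) (at y) w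
         - frechet_derivative (\<lambda>y'. G y' u w) (at y) z) / 2)"


section \<open>Hyperbolic attractors\<close>

text \<open>The projection onto \<open>V\<close> along \<open>W\<close>.\<close>
definition proj_along :: "'e::euclidean_space set \<Rightarrow> 'e set \<Rightarrow> 'e \<Rightarrow>\<^sub>L 'e" where
  "proj_along V W = Blinfun (\<lambda>u. THE a. a \<in> V \<and> u - a \<in> W)"

definition direct_sum3 :: "'e::euclidean_space set \<Rightarrow> 'e set \<Rightarrow> 'e set \<Rightarrow> bool" where
  "direct_sum3 V1 V2 V3 \<longleftrightarrow> subspace V1 \<and> subspace V2 \<and> subspace V3 \<and>
     (\<forall>u. \<exists>a\<in>V1. \<exists>b\<in>V2. \<exists>c\<in>V3. u = a + b + c) \<and>
     (\<forall>a\<in>V1. \<forall>b\<in>V2. \<forall>c\<in>V3. a + b + c = 0 \<longrightarrow> a = 0 \<and> b = 0 \<and> c = 0)"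

definition Ps :: "('m \<Rightarrow> 'e::euclidean_space) \<Rightarrow> ('m \<Rightarrow> 'e set) \<Rightarrow> ('m \<Rightarrow> 'e set) \<Rightarrow> 'm \<Rightarrow> 'e \<Rightarrow>\<^sub>L 'e" where
  "Ps F Vs Vu p = proj_along (Vs p) (span (Vu p \<union> {F p}))"

definition Pu :: "('m \<Rightarrow> 'e::euclidean_space) \<Rightarrow> ('m \<Rightarrow> 'e set) \<Rightarrow> ('m \<Rightarrow> 'e set) \<Rightarrow> 'm \<Rightarrow> 'e \<Rightarrow>\<^sub>L 'e" where
  "Pu F Vs Vu p = proj_along (Vu p) (span (Vs p \<union> {F p}))"

definition Pc :: "('m \<Rightarrow> 'e::euclidean_space) \<Rightarrow> ('m \<Rightarrow> 'e set) \<Rightarrow> ('m \<Rightarrow> 'e set) \<Rightarrow> 'm \<Rightarrow> 'e \<Rightarrow>\<^sub>L 'e" where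
  "Pc F Vs Vu p = proj_along (span {F p}) (span (Vs p \<union> Vu p))"

text \<open>The covector \<open>\<epsilon>\<^sup>c\<close>.\<close>
definition eps_c ::
    "('m \<Rightarrow> 'e::euclidean_space) \<Rightarrow> ('m \<Rightarrow> 'e set) \<Rightarrow> ('m \<Rightarrow> 'e set) \<Rightarrow> 'm \<Rightarrow> 'e \<Rightarrow>\<^sub>L real" where
  "eps_c F Vs Vu p = (THE e. (\<forall>u\<in>Vs p \<union> Vu p. blinfun_apply e u = 0) \<and> blinfun_apply e (F p) = 1)"

definition continuous_endo_on ::
  "('m::topological_space, 'e::euclidean_space) chart set \<Rightarrow> 'm set \<Rightarrow> ('m \<Rightarrow> 'e \<Rightarrow>\<^sub>L 'e) \<Rightarrow> bool" where
  "continuous_endo_on A K P \<longleftrightarrow>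
     (\<forall>c\<in>A. continuous_on (K \<inter> cdom c) (\<lambda>p. to_chart A c p o\<^sub>L P p o\<^sub>L of_chart A c p))"

text \<open>
  The splitting of \<open>T\<^sub>K M\<close> has the summands \<open>Vs p\<close>, \<open>Vu p\<close> and \<open>span {F p}\<close> at \<open>p \<in> K\<close>; a splitting
  is continuous when its projections are. Invariance of \<open>K\<close>, presupposed when one speaks of an
  invariant splitting over \<open>K\<close>, also follows from the condition on the neighbourhood \<open>U\<close>.
\<close>
definition hyperbolic_attractor ::
  "('m::topological_space, 'e::euclidean_space) chart set \<Rightarrow> ('m \<Rightarrow> 'e \<Rightarrow> 'e \<Rightarrow> real)
    \<Rightarrow> ('m \<Rightarrow> 'e) \<Rightarrow> (real \<Rightarrow> 'm \<Rightarrow> 'm) \<Rightarrow> 'm set \<Rightarrow> ('m \<Rightarrow> 'e set) \<Rightarrow> ('m \<Rightarrow> 'e set) \<Rightarrow> bool" where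
  "hyperbolic_attractor A g F f K Vs Vu \<longleftrightarrow>
     compact K \<and> (\<forall>t. f t ` K = K) \<and>
     (\<forall>p\<in>K. direct_sum3 (Vs p) (Vu p) (span {F p})) \<and>
     continuous_endo_on A K (Ps F Vs Vu) \<and>
     continuous_endo_on A K (Pu F Vs Vu) \<and>
     continuous_endo_on A K (Pc F Vs Vu) \<and>
     (\<forall>p\<in>K. \<forall>t. blinfun_apply (pushforward A (f t) p) ` Vs p = Vs (f t p) \<and>
                blinfun_apply (pushforward A (f t) p) ` Vu p = Vu (f t p)) \<and>
     (\<exists>C>0. \<exists>l. 0 < l \<and> l < 1 \<and>
        (\<forall>p\<in>K. \<forall>t\<ge>0.
           (\<forall>u\<in>Vu p. rnorm g (f (- t) p) (pushforward A (f (- t)) p u) \<le> C * l powr t * rnorm g p u) \<and>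
           (\<forall>u\<in>Vs p. rnorm g (f t p) (pushforward A (f t) p u) \<le> C * l powr t * rnorm g p u))) \<and>
     (\<exists>U. open U \<and> K \<subseteq> U \<and> (\<Inter>t\<in>{0..}. f t ` U) = K)"


section \<open>Fields along an orbit\<close>

text \<open>
  A curve is a map \<open>x :: real \<Rightarrow> 'm\<close>, and fields along it are functions of time, so that points at
  different times count as distinct.
\<close>

definition orbit :: "(real \<Rightarrow> 'm \<Rightarrow> 'm) \<Rightarrow> 'm \<Rightarrow> real \<Rightarrow> 'm" where
  "orbit f x0 t = f t x0"

definition vfields ::
  "('m, 'e::euclidean_space) chart set \<Rightarrow> ('m \<Rightarrow> 'e \<Rightarrow> 'e \<Rightarrow> real) \<Rightarrow> (real \<Rightarrow> 'm) \<Rightarrow> (real \<Rightarrow> 'e) set" where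
  "vfields A g x = {v.
     (\<forall>c\<in>A. continuous_on {t. x t \<in> cdom c} (\<lambda>t. to_chart A c (x t) (v t))) \<and>
     (\<exists>B. \<forall>t. rnorm g (x t) (v t) \<le> B)}"

definition covfields ::
  "('m, 'e::euclidean_space) chart set \<Rightarrow> ('m \<Rightarrow> 'e \<Rightarrow> 'e \<Rightarrow> real) \<Rightarrow> (real \<Rightarrow> 'm)
    \<Rightarrow> (real \<Rightarrow> 'e \<Rightarrow>\<^sub>L real) set" where
  "covfields A g x = {\<omega>.
     (\<forall>c\<in>A. continuous_on {t. x t \<in> cdom c} (\<lambda>t. \<omega> t o\<^sub>L of_chart A c (x t))) \<and>
     (\<exists>B. \<forall>t u. \<bar>\<omega> t u\<bar> \<le> B * rnorm g (x t) u)}"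

definition funs :: "(real \<Rightarrow> real) set" where
  "funs = {\<eta>. continuous_on UNIV \<eta> \<and> bounded (range \<eta>)}"

definition C1_vfields ::
  "('m, 'e::euclidean_space) chart set \<Rightarrow> ('m \<Rightarrow> 'e \<Rightarrow> 'e \<Rightarrow> real) \<Rightarrow> (real \<Rightarrow> 'm) \<Rightarrow> (real \<Rightarrow> 'e) set" where
  "C1_vfields A g x = {v\<in>vfields A g x.
     \<forall>c\<in>A. (\<lambda>t. to_chart A c (x t) (v t)) C1_differentiable_on {t. x t \<in> cdom c}}"

definition C1_funs :: "(real \<Rightarrow> real) set" where
  "C1_funs = {\<psi>\<in>funs. \<psi> C1_differentiable_on UNIV}"

definition differentiable_covfield ::
  "('m, 'e::euclidean_space) chart set \<Rightarrow> (real \<Rightarrow> 'm) \<Rightarrow> (real \<Rightarrow> 'e \<Rightarrow>\<^sub>L real) \<Rightarrow> bool" where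
  "differentiable_covfield A x \<nu> \<longleftrightarrow>
     (\<forall>c\<in>A. \<forall>t. x t \<in> cdom c \<longrightarrow> (\<lambda>s. \<nu> s o\<^sub>L of_chart A c (x s)) differentiable (at t))"

text \<open>
  In the next definitions \<open>x\<close> is an orbit of the flow \<open>f\<close>, so that \<open>f\<^sub>*\<^sup>-\<^sup>t\<close> maps \<open>T\<^bsub>x(\<tau>+t)\<^esub> M\<close> to
  \<open>T\<^bsub>x(\<tau>)\<^esub> M\<close> and the Lie derivative is the derivative of a curve in the vector space
  \<open>T\<^bsub>x(\<tau>)\<^esub> M\<close>, respectively in its dual.
\<close>

definition lie_vec ::
  "('m, 'e::euclidean_space) chart set \<Rightarrow> (real \<Rightarrow> 'm \<Rightarrow> 'm) \<Rightarrow> (real \<Rightarrow> 'm) \<Rightarrow> (real \<Rightarrow> 'e)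
    \<Rightarrow> real \<Rightarrow> 'e" where
  "lie_vec A f x v \<tau> =
     vector_derivative (\<lambda>t. pushforward A (f (- t)) (x (\<tau> + t)) (v (\<tau> + t))) (at 0)"

definition lie_cov ::
  "('m, 'e::euclidean_space) chart set \<Rightarrow> (real \<Rightarrow> 'm \<Rightarrow> 'm) \<Rightarrow> (real \<Rightarrow> 'm) \<Rightarrow> (real \<Rightarrow> 'e \<Rightarrow>\<^sub>L real)
    \<Rightarrow> real \<Rightarrow> 'e \<Rightarrow>\<^sub>L real" where
  "lie_cov A f x \<nu> \<tau> =
     vector_derivative (\<lambda>t. pullback A (f t) (x \<tau>) (\<nu> (\<tau> + t))) (at 0)"

text \<open>
  The covariant derivative \<open>\<nabla>\<^sub>F \<nu>\<close> along \<open>x\<close>, computed in the preferred chart at \<open>x \<tau>\<close>: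
  \<open>(\<nabla>\<^sub>F \<nu>)(Y) = (d\<nu>/dt)(Y) - \<nu>(\<Gamma>(F, Y))\<close>.
\<close>
definition nabla_F ::
  "('m, 'e::euclidean_space) chart set \<Rightarrow> ('m \<Rightarrow> 'e \<Rightarrow> 'e \<Rightarrow> real) \<Rightarrow> ('m \<Rightarrow> 'e) \<Rightarrow> (real \<Rightarrow> 'm)
    \<Rightarrow> (real \<Rightarrow> 'e \<Rightarrow>\<^sub>L real) \<Rightarrow> real \<Rightarrow> 'e \<Rightarrow>\<^sub>L real" where
  "nabla_F A g F x \<nu> \<tau> =
     (let c = chart_at A (x \<tau>) in
      vector_derivative (\<lambda>t. \<nu> t o\<^sub>L of_chart A c (x t)) (at \<tau>)
      - (\<nu> \<tau> o\<^sub>L Blinfun (christoffel A g c (cmap c (x \<tau>)) (F (x \<tau>)))))"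

text \<open>
  \<open>\<nabla>\<^sub>\<nu> F\<close> is by definition this difference; as the connection is torsion free, it is
  \<open>(\<nabla>\<^sub>\<nu> F)(Y) = -\<nu>(\<nabla>\<^sub>Y F)\<close>.
\<close>
definition nabla_nu ::
  "('m, 'e::euclidean_space) chart set \<Rightarrow> ('m \<Rightarrow> 'e \<Rightarrow> 'e \<Rightarrow> real) \<Rightarrow> ('m \<Rightarrow> 'e)
    \<Rightarrow> (real \<Rightarrow> 'm \<Rightarrow> 'm) \<Rightarrow> (real \<Rightarrow> 'm) \<Rightarrow> (real \<Rightarrow> 'e \<Rightarrow>\<^sub>L real) \<Rightarrow> real \<Rightarrow> 'e \<Rightarrow>\<^sub>L real" where
  "nabla_nu A g F f x \<nu> \<tau> = nabla_F A g F x \<nu> \<tau> - lie_cov A f x \<nu> \<tau>"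


section \<open>Tangent and adjoint shadowing\<close>

definition shadow_pairs ::
  "('m, 'e::euclidean_space) chart set \<Rightarrow> ('m \<Rightarrow> 'e \<Rightarrow> 'e \<Rightarrow> real) \<Rightarrow> (real \<Rightarrow> 'm)
    \<Rightarrow> ((real \<Rightarrow> 'e) \<times> (real \<Rightarrow> real)) set" where
  "shadow_pairs A g x = C1_vfields A g x \<times> funs"

definition perturbation ::
  "('m, 'e::euclidean_space) chart set \<Rightarrow> ('m \<Rightarrow> 'e) \<Rightarrow> (real \<Rightarrow> 'm \<Rightarrow> 'm) \<Rightarrow> (real \<Rightarrow> 'm)
    \<Rightarrow> (real \<Rightarrow> 'e) \<times> (real \<Rightarrow> real) \<Rightarrow> real \<Rightarrow> 'e" where
  "perturbation A F f x = (\<lambda>(v, \<eta>) t. lie_vec A f x v t + \<eta> t *\<^sub>R F (x t))"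

definition shadow_rel ::
  "('m, 'e::euclidean_space) chart set \<Rightarrow> ('m \<Rightarrow> 'e \<Rightarrow> 'e \<Rightarrow> real) \<Rightarrow> ('m \<Rightarrow> 'e)
    \<Rightarrow> (real \<Rightarrow> 'm \<Rightarrow> 'm) \<Rightarrow> (real \<Rightarrow> 'm) \<Rightarrow> ((real \<Rightarrow> 'e) \<times> (real \<Rightarrow> real)) rel" where
  "shadow_rel A g F f x =
     {(a, b). a \<in> shadow_pairs A g x \<and> b \<in> shadow_pairs A g x \<and>
              perturbation A F f x a = perturbation A F f x b}"

definition shadow_space ::
  "('m, 'e::euclidean_space) chart set \<Rightarrow> ('m \<Rightarrow> 'e \<Rightarrow> 'e \<Rightarrow> real) \<Rightarrow> ('m \<Rightarrow> 'e)
    \<Rightarrow> (real \<Rightarrow> 'm \<Rightarrow> 'm) \<Rightarrow> (real \<Rightarrow> 'm) \<Rightarrow> ((real \<Rightarrow> 'e) \<times> (real \<Rightarrow> real)) set set" where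
  "shadow_space A g F f x = shadow_pairs A g x // shadow_rel A g F f x"

text \<open>The class of all \<open>(v, \<eta>)\<close> with \<open>L\<^sub>F v + \<eta> F = X\<close>.\<close>
definition shadow_op ::
  "('m, 'e::euclidean_space) chart set \<Rightarrow> ('m \<Rightarrow> 'e \<Rightarrow> 'e \<Rightarrow> real) \<Rightarrow> ('m \<Rightarrow> 'e)
    \<Rightarrow> (real \<Rightarrow> 'm \<Rightarrow> 'm) \<Rightarrow> (real \<Rightarrow> 'm) \<Rightarrow> (real \<Rightarrow> 'e) \<Rightarrow> ((real \<Rightarrow> 'e) \<times> (real \<Rightarrow> real)) set" where
  "shadow_op A g F f x X =
     (THE q. q \<in> shadow_space A g F f x \<and> (\<forall>a\<in>q. perturbation A F f x a = X))"

definition adjoint_pairs ::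
  "('m, 'e::euclidean_space) chart set \<Rightarrow> ('m \<Rightarrow> 'e \<Rightarrow> 'e \<Rightarrow> real) \<Rightarrow> ('m \<Rightarrow> 'e) \<Rightarrow> (real \<Rightarrow> 'm)
    \<Rightarrow> ((real \<Rightarrow> 'e \<Rightarrow>\<^sub>L real) \<times> (real \<Rightarrow> real)) set" where
  "adjoint_pairs A g F x =
     {(\<omega>, \<psi>). \<omega> \<in> covfields A g x \<and> \<psi> \<in> C1_funs \<and>
              (\<forall>t. vector_derivative \<psi> (at t) = \<omega> t (F (x t)))}"

text \<open>
  The product at finite \<open>T\<close> is a function of a representative \<open>(v, \<eta>)\<close>; it does not descend to the
  quotient.
\<close>
definition shadow_product ::
  "(real \<Rightarrow> 'e::euclidean_space) \<times> (real \<Rightarrow> real) \<Rightarrow> (real \<Rightarrow> 'e \<Rightarrow>\<^sub>L real) \<Rightarrow> (real \<Rightarrow> real) \<Rightarrow> real \<Rightarrow> real" where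
  "shadow_product = (\<lambda>(v, \<eta>) \<omega> \<psi> T. 1 / (2 * T) * integral {- T..T} (\<lambda>t. \<omega> t (v t) - \<eta> t * \<psi> t))"

definition weak_characterization ::
  "('m, 'e::euclidean_space) chart set \<Rightarrow> ('m \<Rightarrow> 'e \<Rightarrow> 'e \<Rightarrow> real) \<Rightarrow> ('m \<Rightarrow> 'e)
    \<Rightarrow> (real \<Rightarrow> 'm \<Rightarrow> 'm) \<Rightarrow> (real \<Rightarrow> 'm) \<Rightarrow> (real \<Rightarrow> 'e \<Rightarrow>\<^sub>L real) \<Rightarrow> (real \<Rightarrow> real)
    \<Rightarrow> (real \<Rightarrow> 'e \<Rightarrow>\<^sub>L real) \<Rightarrow> bool" where
  "weak_characterization A g F f x \<omega> \<psi> \<nu> \<longleftrightarrow>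
     (\<forall>X\<in>vfields A g x. \<forall>a\<in>shadow_op A g F f x X.
        ((\<lambda>T. shadow_product a \<omega> \<psi> T - 1 / (2 * T) * integral {- T..T} (\<lambda>t. \<nu> t (X t))) \<longlongrightarrow> 0) at_top)"

definition expansion_formula ::
  "('m, 'e::euclidean_space) chart set \<Rightarrow> ('m \<Rightarrow> 'e) \<Rightarrow> (real \<Rightarrow> 'm \<Rightarrow> 'm)
    \<Rightarrow> ('m \<Rightarrow> 'e set) \<Rightarrow> ('m \<Rightarrow> 'e set) \<Rightarrow> (real \<Rightarrow> 'm) \<Rightarrow> (real \<Rightarrow> 'e \<Rightarrow>\<^sub>L real) \<Rightarrow> (real \<Rightarrow> real)
    \<Rightarrow> (real \<Rightarrow> 'e \<Rightarrow>\<^sub>L real) \<Rightarrow> bool" where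
  "expansion_formula A F f Vs Vu x \<omega> \<psi> \<nu> \<longleftrightarrow>
     (\<forall>\<tau>. let hs = (\<lambda>t. pullback A (f (t - \<tau>)) (x \<tau>) (\<omega> t o\<^sub>L Ps F Vs Vu (x t)));
              hu = (\<lambda>t. pullback A (f (t - \<tau>)) (x \<tau>) (\<omega> t o\<^sub>L Pu F Vs Vu (x t)))
          in hs integrable_on {\<tau>..} \<and> hu integrable_on {..\<tau>} \<and>
             \<nu> \<tau> = integral {\<tau>..} hs - integral {..\<tau>} hu - \<psi> \<tau> *\<^sub>R eps_c F Vs Vu (x \<tau>))"

text \<open>\<open>N\<close> is the set of times at which the normalization \<open>\<nu>(F) = -\<psi>\<close> is imposed.\<close>
definition adjoint_solution ::
  "('m, 'e::euclidean_space) chart set \<Rightarrow> ('m \<Rightarrow> 'e \<Rightarrow> 'e \<Rightarrow> real) \<Rightarrow> ('m \<Rightarrow> 'e)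
    \<Rightarrow> (real \<Rightarrow> 'm \<Rightarrow> 'm) \<Rightarrow> (real \<Rightarrow> 'm) \<Rightarrow> (real \<Rightarrow> 'e \<Rightarrow>\<^sub>L real) \<Rightarrow> (real \<Rightarrow> real) \<Rightarrow> real set
    \<Rightarrow> (real \<Rightarrow> 'e \<Rightarrow>\<^sub>L real) \<Rightarrow> bool" where
  "adjoint_solution A g F f x \<omega> \<psi> N \<nu> \<longleftrightarrow>
     \<nu> \<in> covfields A g x \<and> differentiable_covfield A x \<nu> \<and>
     (\<forall>\<tau>. nabla_F A g F x \<nu> \<tau> - nabla_nu A g F f x \<nu> \<tau> = lie_cov A f x \<nu> \<tau> \<and>
          lie_cov A f x \<nu> \<tau> = - \<omega> \<tau>) \<and>
     (\<forall>\<tau>\<in>N. \<nu> \<tau> (F (x \<tau>)) = - \<psi> \<tau>)"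

definition unique_adjoint_solution ::
  "('m, 'e::euclidean_space) chart set \<Rightarrow> ('m \<Rightarrow> 'e \<Rightarrow> 'e \<Rightarrow> real) \<Rightarrow> ('m \<Rightarrow> 'e)
    \<Rightarrow> (real \<Rightarrow> 'm \<Rightarrow> 'm) \<Rightarrow> (real \<Rightarrow> 'm) \<Rightarrow> (real \<Rightarrow> 'e \<Rightarrow>\<^sub>L real) \<Rightarrow> (real \<Rightarrow> real) \<Rightarrow> real set
    \<Rightarrow> (real \<Rightarrow> 'e \<Rightarrow>\<^sub>L real) \<Rightarrow> bool" where
  "unique_adjoint_solution A g F f x \<omega> \<psi> N \<nu> \<longleftrightarrow>
     adjoint_solution A g F f x \<omega> \<psi> N \<nu> \<and>
     (\<forall>\<nu>'. adjoint_solution A g F f x \<omega> \<psi> N \<nu>' \<longrightarrow> \<nu>' = \<nu>)"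

end

theory Submission
  imports Defs
begin

text \<open>
  The tangent maps \<open>\<Phi>\<^sub>t : T\<^bsub>x(0)\<^esub> M \<rightarrow> T\<^bsub>x(t)\<^esub> M\<close> transport all fields along the orbit to curves in the fixed
  space \<open>T\<^bsub>x(0)\<^esub> M\<close> and its dual, where the Lie derivative becomes \<open>d/dt\<close> and the splitting becomes
  constant. The adjoint equation turns into \<open>\<nu>' = -\<omega>\<close>; on \<open>V\<^sup>s\<close> a transported bounded covector decays
  as \<open>t \<rightarrow> \<infinity>\<close>, on \<open>V\<^sup>u\<close> as \<open>t \<rightarrow> -\<infinity>\<close>, and on \<open>F\<close> the normalization fixes it, so integrating from
  \<open>\<plusminus>\<infinity>\<close> gives the expansion formula and uniqueness. For the weak characterization, \<open>L\<^sub>F v + \<eta> F = X\<close>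
  gives \<open>\<omega> v - \<eta> \<psi> - \<nu> X = -d(\<nu> v)/dt\<close>, whose time average tends to 0 as \<open>\<nu> v\<close> is bounded; that
  the tangent shadowing operator is defined at all requires a bounded solution \<open>v\<close>, for which the
  projections must be bounded on the compact set \<open>K\<close>.
\<close>

section \<open>Operator-valued maps and improper integrals\<close>

text \<open>Preferred charts may jump along the orbit, so the components of a regular field at
  \<open>x t\<close> need not be continuous in t. After transport only jacobians between fixed
  charts remain; these are partial derivatives of the smooth map (t, y) -> f^t(y), so the
  transported curves inherit the regularity of the fields. The price is that transport does not
  preserve Riemannian length: a bounded field may have an unbounded transported curve. Hence
  estimates come in two forms: decay at \<open>x0\<close> on one half-line, which makes the improper
  integrals converge, and a bound in the metric at \<open>x t\<close> uniform in t, which makes the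
  shadowing field bounded. The direction of F is neither contracted nor expanded, so it cannot be
  integrated from infinity; on the tangent side it is absorbed by \<eta>, whose term cancels against
  \<psi> in the pairing. As the shadowing class is a definite description, solvability for every X
  must precede any statement about its members.\<close>

lemma blinfun_basis_expansion:
  fixes L :: "'a::euclidean_space \<Rightarrow>\<^sub>L 'b::real_normed_vector"
  shows "L = (\<Sum>i\<in>Basis. blinfun_scaleR_left (L i) o\<^sub>L blinfun_inner_right i)"
proof (rule blinfun_eqI)
  fix u
  have "L u = L (\<Sum>i\<in>Basis. (u \<bullet> i) *\<^sub>R i)"
    by (simp add: euclidean_representation)
  then show "L u = (\<Sum>i\<in>Basis. blinfun_scaleR_left (L i) o\<^sub>L blinfun_inner_right i) u"
    by (simp add: blinfun.sum_left blinfun.sum_right blinfun.scaleR_right inner_commute)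
qed

lemma bounded_linear_rank_one:
  "bounded_linear (\<lambda>v. blinfun_scaleR_left v o\<^sub>L blinfun_inner_right i)"
  by (intro bounded_linear_intros)

text \<open>Finite dimension of the domain makes an operator-valued curve a finite sum of rank-one
  operators built from its values on a basis. Testing on fixed vectors suits the jacobians, whose
  time dependence is obtained one vector at a time.\<close>

lemma differentiable_blinfunI:
  fixes L :: "'c::real_normed_vector \<Rightarrow> 'a::euclidean_space \<Rightarrow>\<^sub>L 'b::real_normed_vector"
  assumes "\<And>u. (\<lambda>t. blinfun_apply (L t) u) differentiable (at t within S)"
  shows "L differentiable (at t within S)"
proof -
  have "(\<lambda>t. blinfun_scaleR_left (L t i) o\<^sub>L blinfun_inner_right i) differentiable (at t within S)" for i
    using assms[of i] bounded_linear.has_derivative[OF bounded_linear_rank_one]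
    unfolding differentiable_def by blast
  then have "(\<lambda>t. \<Sum>i\<in>Basis. blinfun_scaleR_left (L t i) o\<^sub>L blinfun_inner_right i)
      differentiable (at t within S)"
    by (intro differentiable_sum) auto
  then show ?thesis
    by (simp flip: blinfun_basis_expansion)
qed

lemma differentiable_blinfun_compose:
  assumes "L differentiable (at t)" "M differentiable (at t)"
  shows "(\<lambda>s. L s o\<^sub>L M s) differentiable (at t)"
  using assms bounded_bilinear.FDERIV[OF bounded_bilinear_blinfun_compose]
  unfolding differentiable_def by blast

lemma differentiable_blinfun_apply:
  assumes "L differentiable (at t)" "v differentiable (at t)"
  shows "(\<lambda>s. blinfun_apply (L s) (v s)) differentiable (at t)"
  using assms bounded_bilinear.FDERIV[OF bounded_bilinear_blinfun_apply]
  unfolding differentiable_def by blast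

lemma differentiable_transform_open:
  assumes "h differentiable (at t)" "open S" "t \<in> S" "\<And>s. s \<in> S \<Longrightarrow> h s = k s"
  shows "k differentiable (at t)"
  using assms has_derivative_transform_within_open unfolding differentiable_def by blast

lemma has_vector_derivative_translate:
  assumes "(h has_vector_derivative d) (at \<tau>)"
  shows "((\<lambda>t. h (\<tau> + t)) has_vector_derivative d) (at 0)"
proof -
  have "((\<lambda>t. \<tau> + t) has_vector_derivative 1) (at 0)"
    by (auto intro!: derivative_eq_intros)
  from vector_diff_chain_at[OF this, of h d] assms show ?thesis
    by (simp add: o_def)
qed

lemma blinfun_compose_assoc: "(L o\<^sub>L M) o\<^sub>L N = L o\<^sub>L (M o\<^sub>L N)"
  by (rule blinfun_eqI) simp

lemma blinfun_compose_id [simp]: "L o\<^sub>L id_blinfun = L" "id_blinfun o\<^sub>L L = L"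
  by (rule blinfun_eqI, simp)+

lemma has_vector_derivative_chain_at:
  assumes "(\<gamma> has_vector_derivative v) (at t)" "(g has_derivative g') (at (\<gamma> t))"
  shows "((\<lambda>s. g (\<gamma> s)) has_vector_derivative g' v) (at t)"
  using vector_derivative_diff_chain_within[OF assms(1) has_derivative_at_withinI[OF assms(2)]]
  by (simp add: o_def)

lemma Ck_on_SucD:
  assumes "Ck_on (Suc k) S h"
  shows "y \<in> S \<Longrightarrow> h differentiable (at y)"
    and "Ck_on k S (\<lambda>y. frechet_derivative h (at y) u)"
  using assms by simp_all

lemma C1_differentiable_at:
  "h C1_differentiable_on S \<Longrightarrow> t \<in> S \<Longrightarrow> h differentiable (at t)"
  unfolding C1_differentiable_on_def by (auto intro: differentiableI_vector)

lemma integral_blinfun_apply: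
  assumes "h integrable_on S"
  shows "blinfun_apply (integral S h) u = integral S (\<lambda>t. blinfun_apply (h t) u)"
  using integral_linear[OF assms blinfun.bounded_linear_left[of u]] by (simp add: o_def)

section \<open>Exponentially decaying integrals over half-lines\<close>

text \<open>The majorant is normalized at the endpoint \<open>c\<close>, so its total mass
  \<open>B / a\<close> is the same for every \<open>c\<close>; this yields bounds uniform in
  time.\<close>

lemma integrable_exp_tail:
  fixes h :: "real \<Rightarrow> 'a::banach"
  assumes "continuous_on {c..} h" and a: "a > 0"
    and bound: "\<And>t. t \<ge> c \<Longrightarrow> norm (h t) \<le> B * exp (- a * (t - c))"
  shows "h integrable_on {c..}" and "norm (integral {c..} h) \<le> B / a"
proof -
  have *: "((\<lambda>t. B * exp (a * c) * exp (- a * t)) has_integral B * exp (a * c) * (exp (- a * c) / a)) {c..}"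
    by (intro has_integral_mult_right has_integral_exp_minus_to_infinity a)
  moreover have "(\<lambda>t. B * exp (a * c) * exp (- a * t)) = (\<lambda>t. B * exp (- a * (t - c)))"
    by (auto simp: algebra_simps simp flip: exp_add)
  moreover have "B * exp (a * c) * (exp (- a * c) / a) = B / a"
    by (simp add: exp_minus)
  ultimately have g: "((\<lambda>t. B * exp (- a * (t - c))) has_integral B / a) {c..}"
    by (simp only:)
  show int: "h integrable_on {c..}"
  proof (rule integrable_on_all_intervals_integrable_bound)
    fix p q :: real
    have "h integrable_on {max p c..q}"
      by (intro integrable_continuous_interval continuous_on_subset[OF assms(1)]) auto
    moreover have "{max p c..q} = {c..} \<inter> cbox p q"
      by auto
    ultimately show "(\<lambda>t. if t \<in> {c..} then h t else 0) integrable_on cbox p q"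
      by (simp only: integrable_restrict_Int)
  next
    show "norm (h t) \<le> B * exp (- a * (t - c))" if "t \<in> {c..}" for t
      using bound that by simp
    show "(\<lambda>t. B * exp (- a * (t - c))) integrable_on {c..}"
      using g by blast
  qed
  have "norm (integral {c..} h) \<le> integral {c..} (\<lambda>t. B * exp (- a * (t - c)))"
    using int g bound by (intro integral_norm_bound_integral) (auto simp: integrable_on_def)
  then show "norm (integral {c..} h) \<le> B / a"
    by (simp only: integral_unique[OF g])
qed

text \<open>Reflection passes from compact boxes to arbitrary sets through the description of the
  integral by exhausting boxes: a box contains a ball about 0 exactly when its mirror image
  does.\<close>

lemma has_integral_reflect_set:
  fixes h :: "real \<Rightarrow> 'a::banach"
  assumes "(h has_integral I) S"
  shows "((\<lambda>t. h (- t)) has_integral I) (uminus ` S)"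
proof -
  let ?k = "\<lambda>t. if t \<in> S then h t else 0"
  have eq: "(\<lambda>t. if t \<in> uminus ` S then h (- t) else 0) = (\<lambda>t. ?k (- t))"
    by (force simp: image_iff)
  have int: "\<And>a b. ?k integrable_on cbox a b"
    and lim: "\<And>e. e > 0 \<Longrightarrow> \<exists>B>0. \<forall>a b. ball 0 B \<subseteq> cbox a b \<longrightarrow> norm (integral (cbox a b) ?k - I) < e"
    using assms unfolding has_integral_alt' by blast+
  show ?thesis
    unfolding has_integral_alt' eq
  proof (intro conjI allI impI)
    fix a b :: real
    show "(\<lambda>t. ?k (- t)) integrable_on cbox a b"
      using integrable_reflect[of ?k "- a" "- b"] int by simp
  next
    fix e :: real assume "e > 0"
    then obtain B where "B > 0"
      and B: "\<And>a b. ball 0 B \<subseteq> cbox a b \<Longrightarrow> norm (integral (cbox a b) ?k - I) < e"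
      using lim by blast
    have "norm (integral (cbox a b) (\<lambda>t. ?k (- t)) - I) < e" if sub: "ball 0 B \<subseteq> cbox a b" for a b
    proof -
      have "ball 0 B \<subseteq> cbox (- b) (- a)"
      proof
        fix t :: real assume "t \<in> ball 0 B"
        then have "- t \<in> cbox a b"
          using sub by (simp add: subset_iff)
        then show "t \<in> cbox (- b) (- a)"
          by auto
      qed
      moreover have "integral (cbox a b) (\<lambda>t. ?k (- t)) = integral (cbox (- b) (- a)) ?k"
        using integral_reflect[of "- a" "- b" ?k] by simp
      ultimately show ?thesis
        using B by simp
    qed
    with \<open>B > 0\<close> show "\<exists>B>0. \<forall>a b. ball 0 B \<subseteq> cbox a b \<longrightarrow> norm (integral (cbox a b) (\<lambda>t. ?k (- t)) - I) < e"
      by blast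
  qed
qed

lemma reflect_ray:
  fixes h :: "real \<Rightarrow> 'a::banach"
  assumes "(\<lambda>t. h (- t)) integrable_on {- c..}"
  shows "h integrable_on {..c}" and "integral {..c} h = integral {- c..} (\<lambda>t. h (- t))"
proof -
  have "uminus ` {- c..} = {..c}"
    using image_uminus_atLeast[of "- c"] by simp
  then have "(h has_integral integral {- c..} (\<lambda>t. h (- t))) {..c}"
    using has_integral_reflect_set[OF integrable_integral[OF assms]] by simp
  then show "h integrable_on {..c}" and "integral {..c} h = integral {- c..} (\<lambda>t. h (- t))"
    by (auto simp: integrable_on_def integral_unique)
qed

lemma integrable_exp_past:
  fixes h :: "real \<Rightarrow> 'a::banach"
  assumes "continuous_on {..c} h" and a: "a > 0"
    and bound: "\<And>t. t \<le> c \<Longrightarrow> norm (h t) \<le> B * exp (- a * (c - t))"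
  shows "h integrable_on {..c}" and "norm (integral {..c} h) \<le> B / a"
proof -
  have cont: "continuous_on {- c..} (\<lambda>t. h (- t))"
    by (rule continuous_on_compose2[OF assms(1)]) (auto intro!: continuous_intros)
  have "norm (h (- t)) \<le> B * exp (- a * (t - - c))" if "t \<ge> - c" for t
    using bound[of "- t"] that by (simp add: add.commute)
  note tail = integrable_exp_tail[OF cont a this]
  then show "h integrable_on {..c}" and "norm (integral {..c} h) \<le> B / a"
    using reflect_ray[of h c] by auto
qed

text \<open>Decay on t >= 0 serves every lower limit, since a negative one only adds a compact
  interval, where continuity is enough. A transported stable covector decays in this one-sided
  way.\<close>

lemma decaying_tail:
  fixes h :: "real \<Rightarrow> 'a::banach"
  assumes cont: "continuous_on UNIV h" and a: "a > 0"
    and bound: "\<And>t. t \<ge> 0 \<Longrightarrow> norm (h t) \<le> B * exp (- a * t)"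
  shows decaying_tail_integrable: "h integrable_on {c..}"
    and decaying_tail_deriv: "((\<lambda>t. integral {t..} h) has_vector_derivative - h \<tau>) (at \<tau>)"
    and decaying_tail_tendsto: "((\<lambda>t. integral {t..} h) \<longlongrightarrow> 0) at_top"
proof -
  have tail: "h integrable_on {d..}" "norm (integral {d..} h) \<le> B * exp (- a * d) / a" if "d \<ge> 0" for d
  proof -
    have "norm (h t) \<le> B * exp (- a * d) * exp (- a * (t - d))" if "t \<ge> d" for t
      using bound[of t] that \<open>d \<ge> 0\<close> by (simp add: algebra_simps flip: exp_add)
    note integrable_exp_tail[OF continuous_on_subset[OF cont subset_UNIV] a this]
    then show "h integrable_on {d..}" "norm (integral {d..} h) \<le> B * exp (- a * d) / a"
      by simp_all
  qed
  have split: "(h has_integral integral {d..e} h + integral {e..} h) {d..}"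
    if "h integrable_on {e..}" "d \<le> e" for d e
  proof -
    have "(h has_integral integral {d..e} h + integral {e..} h) ({d..e} \<union> {e..})"
      by (intro has_integral_Un integrable_integral that integrable_continuous_interval
          continuous_on_subset[OF cont]) (use that in auto)
    moreover have "{d..e} \<union> {e..} = {d..}"
      using that by auto
    ultimately show ?thesis
      by simp
  qed
  show int: "h integrable_on {c..}" for c
    using tail(1)[of c] split[of 0 c] tail(1)[of 0] by (cases "c \<ge> 0") (auto simp: integrable_on_def)
  \<comment> \<open>The base point \<tau> - 1 makes \<tau> interior to the interval, so the
    fundamental theorem gives a two-sided derivative there.\<close>
  have eq: "integral {t..} h = integral {\<tau> - 1..} h - integral {\<tau> - 1..t} h" if "t \<ge> \<tau> - 1" for t
    using integral_unique[OF split[OF int that]] by simp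
  have "((\<lambda>t. integral {\<tau> - 1..t} h) has_vector_derivative h \<tau>) (at \<tau> within {\<tau> - 1..\<tau> + 1})"
    by (rule integral_has_vector_derivative) (auto intro: continuous_on_subset[OF cont])
  then have "((\<lambda>t. integral {\<tau> - 1..t} h) has_vector_derivative h \<tau>) (at \<tau>)"
    by (simp add: at_within_Icc_at)
  then have "((\<lambda>t. integral {\<tau> - 1..} h - integral {\<tau> - 1..t} h) has_vector_derivative 0 - h \<tau>) (at \<tau>)"
    by (intro derivative_intros)
  then have "((\<lambda>t. integral {t..} h) has_vector_derivative 0 - h \<tau>) (at \<tau>)"
    by (rule has_vector_derivative_transform_within_open[where S = "{\<tau> - 1<..}"]) (auto simp flip: eq)
  then show "((\<lambda>t. integral {t..} h) has_vector_derivative - h \<tau>) (at \<tau>)"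
    by simp
  have "((\<lambda>t. exp (- a * t)) \<longlongrightarrow> 0) at_top"
    using a by (intro filterlim_compose[OF exp_at_bot]
        filterlim_tendsto_neg_mult_at_bot[OF tendsto_const _ filterlim_ident]) simp
  then have "((\<lambda>t. B * exp (- a * t) / a) \<longlongrightarrow> 0) at_top"
    by (auto intro!: tendsto_divide_zero tendsto_mult_right_zero)
  then show "((\<lambda>t. integral {t..} h) \<longlongrightarrow> 0) at_top"
    by (rule Lim_null_comparison[rotated]) (rule eventually_at_top_linorderI[of 0], rule tail(2))
qed

text \<open>Time reversal of the tail; the sign from the reflection cancels the sign of a lower
  limit, so the derivative is now \<open>h\<close> itself.\<close>

lemma decaying_past:
  fixes h :: "real \<Rightarrow> 'a::banach"
  assumes cont: "continuous_on UNIV h" and a: "a > 0"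
    and bound: "\<And>t. t \<le> 0 \<Longrightarrow> norm (h t) \<le> B * exp (a * t)"
  shows decaying_past_integrable: "h integrable_on {..c}"
    and decaying_past_deriv: "((\<lambda>t. integral {..t} h) has_vector_derivative h \<tau>) (at \<tau>)"
    and decaying_past_tendsto: "((\<lambda>t. integral {..t} h) \<longlongrightarrow> 0) at_bot"
proof -
  have cont': "continuous_on UNIV (\<lambda>t. h (- t))"
    by (rule continuous_on_compose2[OF cont]) (auto intro!: continuous_intros)
  have bound': "norm (h (- t)) \<le> B * exp (- a * t)" if "t \<ge> 0" for t
    using bound[of "- t"] that by simp
  note tail = decaying_tail[OF cont' a bound']
  have eq: "(\<lambda>t. integral {..t} h) = (\<lambda>t. integral {- t..} (\<lambda>t. h (- t)))"
    using reflect_ray(2)[OF tail(1)] by auto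
  show "h integrable_on {..c}"
    by (rule reflect_ray(1)[OF tail(1)])
  have "((\<lambda>t. integral {..t} h) has_vector_derivative (-1) *\<^sub>R (- h (- (- \<tau>)))) (at \<tau>)"
    unfolding eq
    by (rule vector_diff_chain_at[of uminus "-1" \<tau> "\<lambda>t. integral {t..} (\<lambda>t. h (- t))", unfolded o_def])
      (use tail(2)[of "- \<tau>"] in \<open>auto intro!: derivative_eq_intros\<close>)
  then show "((\<lambda>t. integral {..t} h) has_vector_derivative h \<tau>) (at \<tau>)"
    by simp
  show "((\<lambda>t. integral {..t} h) \<longlongrightarrow> 0) at_bot"
    unfolding eq by (rule filterlim_compose[OF tail(3) filterlim_uminus_at_top_at_bot])
qed

section \<open>The flow in charts\<close>

lemma cinv_cmap:
  assumes "is_chart c" "p \<in> cdom c"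
  shows "cinv c (cmap c p) = p"
  using assms by (simp add: is_chart_def cinv_def)

lemma continuous_on_cmap: "is_chart c \<Longrightarrow> continuous_on (cdom c) (cmap c)"
  by (simp add: is_chart_def homeomorphism_def)

lemma isCont_cinv:
  assumes "is_chart c" "p \<in> cdom c"
  shows "isCont (cinv c) (cmap c p)"
proof -
  have "continuous_on (cmap c ` cdom c) (cinv c)" "open (cmap c ` cdom c)"
    using assms(1) by (auto simp: is_chart_def homeomorphism_def)
  then show ?thesis
    using assms(2) by (simp add: continuous_on_eq_continuous_at)
qed

text \<open>The derivative of \<open>f\<^sup>t\<close> at \<open>p\<close> in the charts \<open>c\<close> at \<open>p\<close> and \<open>d\<close> at \<open>f\<^sup>t p\<close>. Tangent maps and
  changes of charts (\<open>t = 0\<close>) are both of this form, so that one cocycle rule covers all of them.\<close>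
definition jac ::
  "(real \<Rightarrow> 'm \<Rightarrow> 'm) \<Rightarrow> ('m, 'e::euclidean_space) chart \<Rightarrow> ('m, 'e) chart \<Rightarrow> real \<Rightarrow> 'm \<Rightarrow> 'e \<Rightarrow>\<^sub>L 'e"
  where "jac f c d t p = Blinfun (frechet_derivative (\<lambda>y. cmap d (f t (cinv c y))) (at (cmap c p)))"

locale atlas_flow =
  fixes A :: "('m::{t2_space,second_countable_topology}, 'e::euclidean_space) chart set"
    and F :: "'m \<Rightarrow> 'e" and f :: "real \<Rightarrow> 'm \<Rightarrow> 'm"
  assumes atlas: "smooth_atlas A"
    and flow: "flow_of A F f"
begin

lemma chart: "c \<in> A \<Longrightarrow> is_chart c"
  using atlas by (simp add: smooth_atlas_def)

lemma chart_at: "chart_at A p \<in> A \<and> p \<in> cdom (chart_at A p)"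
proof -
  have "p \<in> (\<Union>c\<in>A. cdom c)"
    using atlas by (simp add: smooth_atlas_def)
  then have "\<exists>c. c \<in> A \<and> p \<in> cdom c"
    by blast
  then show ?thesis
    unfolding chart_at_def by (rule someI_ex)
qed

lemmas chart_at_in [simp, intro] = chart_at[THEN conjunct1] chart_at[THEN conjunct2]

lemma cinv_cmap' [simp]: "c \<in> A \<Longrightarrow> p \<in> cdom c \<Longrightarrow> cinv c (cmap c p) = p"
  by (simp add: chart cinv_cmap)

lemma flow_0 [simp]: "f 0 p = p"
  using flow by (simp add: flow_of_def)

lemma flow_add: "f (s + t) p = f s (f t p)"
  using flow by (simp add: flow_of_def)

lemma continuous_flow: "continuous_on UNIV (\<lambda>(t, p). f t p)"
  using flow by (simp add: flow_of_def)

lemma continuous_flow_time: "continuous_on UNIV (\<lambda>t. f t p)"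
  using continuous_on_compose2[OF continuous_flow _ subset_UNIV, of UNIV "\<lambda>t. (t, p)"]
  by (simp add: continuous_on_Pair)

lemma continuous_flow_space: "continuous_on UNIV (f t)"
  using continuous_on_compose2[OF continuous_flow _ subset_UNIV, of UNIV "\<lambda>p. (t, p)"]
  by (simp add: continuous_on_Pair)

lemma open_times: "c \<in> A \<Longrightarrow> open {t. f t p \<in> cdom c}"
  using open_vimage[OF _ continuous_flow_time, of "cdom c" p] chart[of c]
  by (simp add: is_chart_def vimage_def)

section \<open>Chart derivatives of the flow and their cocycle rule\<close>

lemma Ck_flow_in_charts:
  assumes "c \<in> A" "d \<in> A"
  shows "Ck_on k {(t, y). y \<in> cmap c ` cdom c \<and> f t (cinv c y) \<in> cdom d}
    (\<lambda>(t, y). cmap d (f t (cinv c y)))"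
  using flow assms by (auto simp: flow_of_def smooth_on_def)

lemma flow_in_charts_differentiable:
  assumes "c \<in> A" "d \<in> A" "p \<in> cdom c" "f t p \<in> cdom d"
  shows "(\<lambda>(t, y). cmap d (f t (cinv c y))) differentiable (at (t, cmap c p))"
  using Ck_flow_in_charts[OF assms(1,2), of 1] assms by auto

text \<open>The second form, a directional derivative of the joint map in (t, y), is the one that
  can be differentiated in time. Boundedness and linearity have to be shown first, as
  \<open>Blinfun\<close> is meaningful only for such maps.\<close>

lemma jac_partial:
  assumes "c \<in> A" "d \<in> A" "p \<in> cdom c" "f t p \<in> cdom d"
  shows "((\<lambda>y. cmap d (f t (cinv c y))) has_derivative jac f c d t p) (at (cmap c p))"
    and "jac f c d t p u = frechet_derivative (\<lambda>(t, y). cmap d (f t (cinv c y))) (at (t, cmap c p)) (0, u)"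
proof -
  let ?G = "\<lambda>(t, y). cmap d (f t (cinv c y))"
  have "(?G has_derivative frechet_derivative ?G (at (t, cmap c p))) (at (t, cmap c p))"
    using flow_in_charts_differentiable[OF assms] frechet_derivative_works by blast
  then have der: "((\<lambda>y. ?G (t, y)) has_derivative (\<lambda>u. frechet_derivative ?G (at (t, cmap c p)) (0, u)))
      (at (cmap c p))"
    using has_derivative_compose[OF has_derivative_Pair[OF has_derivative_const has_derivative_ident]]
    by blast
  then have "jac f c d t p = Blinfun (\<lambda>u. frechet_derivative ?G (at (t, cmap c p)) (0, u))"
    unfolding jac_def by (simp flip: frechet_derivative_at)
  then have "blinfun_apply (jac f c d t p) = (\<lambda>u. frechet_derivative ?G (at (t, cmap c p)) (0, u))"
    using der by (simp add: bounded_linear_Blinfun_apply has_derivative_bounded_linear)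
  with der show "((\<lambda>y. cmap d (f t (cinv c y))) has_derivative jac f c d t p) (at (cmap c p))"
    and "jac f c d t p u = frechet_derivative ?G (at (t, cmap c p)) (0, u)"
    by simp_all
qed

lemmas has_derivative_jac = jac_partial(1)

lemma jac_unique:
  assumes "c \<in> A" "d \<in> A" "p \<in> cdom c" "f t p \<in> cdom d"
    and "((\<lambda>y. cmap d (f t (cinv c y))) has_derivative L) (at (cmap c p))"
  shows "blinfun_apply (jac f c d t p) = L"
  using has_derivative_unique[OF has_derivative_jac[OF assms(1-4)] assms(5)] .

lemma eventually_flow_in_chart:
  assumes "c \<in> A" "d \<in> A" "p \<in> cdom c" "f t p \<in> cdom d"
  shows "\<forall>\<^sub>F y in nhds (cmap c p). f t (cinv c y) \<in> cdom d"
proof -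
  have "isCont (\<lambda>y. f t (cinv c y)) (cmap c p)"
    using isCont_cinv[OF chart] continuous_flow_space[of t] assms
    by (intro isCont_o2[of _ "cinv c" "f t"]) (auto simp: continuous_on_eq_continuous_at)
  then have "((\<lambda>y. f t (cinv c y)) \<longlongrightarrow> f t p) (nhds (cmap c p))"
    using assms tendsto_at_iff_tendsto_nhds[of "\<lambda>y. f t (cinv c y)" "cmap c p"]
    by (simp add: isCont_def)
  then show ?thesis
    using chart[OF assms(2)] assms(4) by (auto intro: topological_tendstoD simp: is_chart_def)
qed

text \<open>Chain rule through the intermediate chart \<open>d\<close>. The factor
  \<open>cinv d o cmap d\<close> is the identity only while the point stays in that chart, so the
  two maps are compared near \<open>cmap c p\<close> only.\<close>

lemma jac_compose:
  assumes "c \<in> A" "d \<in> A" "e \<in> A" "p \<in> cdom c" "f t p \<in> cdom d" "f (s + t) p \<in> cdom e"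
  shows "jac f d e s (f t p) o\<^sub>L jac f c d t p = jac f c e (s + t) p"
proof -
  have "((\<lambda>y. cmap e (f s (cinv d (cmap d (f t (cinv c y)))))) has_derivative
      (\<lambda>u. jac f d e s (f t p) (jac f c d t p u))) (at (cmap c p))"
    using has_derivative_jac[of d e "f t p" s] assms
    by (intro has_derivative_compose[OF has_derivative_jac[OF assms(1,2,4,5)]]) (simp add: flow_add)
  moreover have "\<forall>\<^sub>F y in nhds (cmap c p).
      cmap e (f s (cinv d (cmap d (f t (cinv c y))))) = cmap e (f (s + t) (cinv c y))"
    using eventually_flow_in_chart[OF assms(1,2,4,5)]
    by eventually_elim (simp add: assms(2) flow_add)
  ultimately have "((\<lambda>y. cmap e (f (s + t) (cinv c y))) has_derivative
      (\<lambda>u. jac f d e s (f t p) (jac f c d t p u))) (at (cmap c p))"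
    by (auto simp: eventually_nhds_conv_at intro: has_derivative_transform_eventually)
  then show ?thesis
    using jac_unique[OF assms(1,3,4,6)] by (intro blinfun_eqI) simp
qed

lemma jac_id:
  assumes "c \<in> A" "p \<in> cdom c"
  shows "jac f c c 0 p = id_blinfun"
proof -
  have "((\<lambda>y. cmap c (f 0 (cinv c y))) has_derivative (\<lambda>u. u)) (at (cmap c p))"
    by (rule has_derivative_transform_within_open[OF has_derivative_ident, where s = "cmap c ` cdom c"])
      (use chart[OF assms(1)] assms in \<open>auto simp: is_chart_def cinv_cmap[OF chart]\<close>)
  then show ?thesis
    using jac_unique[OF assms(1,1,2)] assms by (intro blinfun_eqI) simp
qed

lemma pushforward_jac: "pushforward A (f t) p = jac f (chart_at A p) (chart_at A (f t p)) t p"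
  by (simp add: pushforward_def jac_def o_def)

lemma to_chart_jac: "to_chart A c p = jac f (chart_at A p) c 0 p"
  by (simp add: to_chart_def jac_def o_def)

lemma of_chart_jac: "of_chart A c p = jac f c (chart_at A p) 0 p"
  by (simp add: of_chart_def jac_def o_def)

text \<open>The flow equation is postulated only in the preferred chart at the current point; the
  transition map carries it to any other chart.\<close>

lemma jac_generator:
  assumes "c \<in> A" "p \<in> cdom c"
  shows "((\<lambda>s. cmap c (f s p)) has_vector_derivative to_chart A c p (F p)) (at 0)"
proof -
  let ?d = "chart_at A p"
  have "((\<lambda>s. cmap ?d (f s p)) has_vector_derivative F p) (at 0)"
  proof -
    have "((\<lambda>s. cmap (chart_at A (f 0 p)) (f s p)) has_vector_derivative F (f 0 p)) (at 0)"
      using flow unfolding flow_of_def by blast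
    then show ?thesis
      by simp
  qed
  then have "((\<lambda>s. cmap c (cinv ?d (cmap ?d (f s p)))) has_vector_derivative to_chart A c p (F p)) (at 0)"
    using has_derivative_jac[of ?d c p 0] assms unfolding to_chart_jac
    by (intro has_vector_derivative_chain_at[where g = "\<lambda>y. cmap c (cinv ?d y)"]) simp_all
  then show ?thesis
    by (rule has_vector_derivative_transform_within_open[where S = "{s. f s p \<in> cdom ?d}"])
      (auto intro: open_times)
qed

text \<open>f^t and f^s commute, so differentiating the curve s -> f^(t+s)(p) at s = 0 in two ways
  gives the same vector.\<close>

lemma pushforward_F: "pushforward A (f t) p (F p) = F (f t p)"
proof -
  let ?c = "chart_at A p" and ?d = "chart_at A (f t p)"
  have c: "((\<lambda>s. cmap ?c (f s p)) has_vector_derivative F p) (at 0)"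
    using jac_generator[of ?c p] by (simp add: to_chart_jac jac_id)
  have d: "((\<lambda>s. cmap ?d (f s (f t p))) has_vector_derivative F (f t p)) (at 0)"
    using jac_generator[of ?d "f t p"] by (simp add: to_chart_jac jac_id)
  have "((\<lambda>s. cmap ?d (f t (cinv ?c (cmap ?c (f s p))))) has_vector_derivative
      jac f ?c ?d t p (F p)) (at 0)"
    using has_derivative_jac[of ?c ?d p t] c
    by (intro has_vector_derivative_chain_at[where g = "\<lambda>y. cmap ?d (f t (cinv ?c y))"]) simp_all
  then have "((\<lambda>s. cmap ?d (f s (f t p))) has_vector_derivative jac f ?c ?d t p (F p)) (at 0)"
    by (rule has_vector_derivative_transform_within_open[where S = "{s. f s p \<in> cdom ?c}"])
      (auto intro: open_times simp flip: flow_add simp: add.commute)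
  from vector_derivative_unique_at[OF this d] show ?thesis
    by (simp add: pushforward_jac)
qed

section \<open>Time regularity of the jacobians\<close>

text \<open>\<open>D\<close> is a mixed second derivative of the joint map, first in the direction
  (0, u), then in the direction (1, 0); its existence and continuity use the C^2 case of
  smoothness.\<close>

lemma jac_time_deriv:
  assumes "c \<in> A" "d \<in> A" "p \<in> cdom c"
  obtains D where "\<And>t. f t p \<in> cdom d \<Longrightarrow> ((\<lambda>t. jac f c d t p u) has_vector_derivative D t) (at t)"
    and "continuous_on {t. f t p \<in> cdom d} D"
proof -
  let ?G = "\<lambda>(t, y). cmap d (f t (cinv c y))"
  let ?S = "{(t, y). y \<in> cmap c ` cdom c \<and> f t (cinv c y) \<in> cdom d}"
  let ?E = "\<lambda>z. frechet_derivative ?G (at z) (0, u)"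
  let ?z = "\<lambda>t. (t, cmap c p)"
  define D where "D t = frechet_derivative ?E (at (?z t)) (1, 0)" for t
  have "Ck_on (Suc (Suc 0)) ?S ?G"
    using Ck_flow_in_charts assms by blast
  note E = Ck_on_SucD(2)[OF this, of "(0, u)"]
  note diff = Ck_on_SucD(1)[OF E]
  have cont: "continuous_on ?S (\<lambda>z. frechet_derivative ?E (at z) (1, 0))"
    using Ck_on_SucD(2)[OF E] by simp
  have z: "?z t \<in> ?S" if "f t p \<in> cdom d" for t
    using that assms by auto
  show thesis
  proof
    fix t assume t: "f t p \<in> cdom d"
    have "(?E has_derivative frechet_derivative ?E (at (?z t))) (at (?z t))"
      using diff[OF z[OF t]] frechet_derivative_works by blast
    moreover have "(?z has_vector_derivative (1, 0)) (at t)"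
      by (intro has_vector_derivative_Pair) (auto intro!: derivative_eq_intros)
    ultimately have "((\<lambda>s. ?E (?z s)) has_vector_derivative D t) (at t)"
      unfolding D_def by (intro has_vector_derivative_chain_at[where g = ?E])
    then show "((\<lambda>t. jac f c d t p u) has_vector_derivative D t) (at t)"
      by (rule has_vector_derivative_transform_within_open[where S = "{s. f s p \<in> cdom d}"])
        (auto intro: open_times t assms simp: jac_partial(2) assms)
  next
    show "continuous_on {t. f t p \<in> cdom d} D"
      unfolding D_def by (rule continuous_on_compose2[OF cont]) (use z in \<open>auto intro!: continuous_intros\<close>)
  qed
qed

text \<open>Time and base point move together, so the chain rule is applied to the curve (-s,
  f^s(p)) inside the joint map. The endpoint f^(-s)(f^s(p)) = p never leaves the chart
  \<open>d\<close>.\<close>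

lemma jac_backward_differentiable:
  assumes "c \<in> A" "d \<in> A" "p \<in> cdom d" "f t p \<in> cdom c"
  shows "(\<lambda>s. jac f c d (- s) (f s p)) differentiable (at t)"
proof (rule differentiable_blinfunI)
  fix u
  let ?G = "\<lambda>(t, y). cmap d (f t (cinv c y))"
  let ?E = "\<lambda>z. frechet_derivative ?G (at z) (0, u)"
  let ?z = "\<lambda>s. (- s, cmap c (f s p))"
  have ret: "f (- s) (f s p) = p" for s
    by (simp flip: flow_add)
  have "Ck_on (Suc (Suc 0)) {(t, y). y \<in> cmap c ` cdom c \<and> f t (cinv c y) \<in> cdom d} ?G"
    using Ck_flow_in_charts assms by blast
  then have E: "?E differentiable (at (?z t))"
    by (rule Ck_on_SucD(1)[OF Ck_on_SucD(2)]) (use assms ret in auto)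
  have "(\<lambda>(s, y). cmap c (f s (cinv d y))) differentiable (at (t, cmap d p))"
    using flow_in_charts_differentiable[of d c p t] assms by simp
  moreover have "(\<lambda>s. (s, cmap d p)) differentiable (at t)"
    by (auto simp: differentiable_def intro!: derivative_eq_intros)
  ultimately have "(\<lambda>s. cmap c (f s p)) differentiable (at t)"
    using differentiable_compose[of "\<lambda>(s, y). cmap c (f s (cinv d y))" "\<lambda>s. (s, cmap d p)"] assms
    by simp
  then obtain L where "((\<lambda>s. cmap c (f s p)) has_derivative L) (at t)"
    by (auto simp: differentiable_def)
  then have "(?z has_derivative (\<lambda>h. (- h, L h))) (at t)"
    by (auto intro!: derivative_eq_intros)
  then have "?z differentiable (at t)"
    by (auto simp: differentiable_def)
  then have "(\<lambda>s. ?E (?z s)) differentiable (at t)"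
    using differentiable_compose[of ?E ?z t UNIV] E by (auto intro: differentiable_at_withinI)
  then obtain L' where "((\<lambda>s. ?E (?z s)) has_derivative L') (at t)"
    by (auto simp: differentiable_def)
  then have "((\<lambda>s. jac f c d (- s) (f s p) u) has_derivative L') (at t)"
    by (rule has_derivative_transform_within_open[where s = "{s. f s p \<in> cdom c}"])
      (auto intro: open_times assms simp: jac_partial(2) assms ret)
  then show "(\<lambda>s. jac f c d (- s) (f s p) u) differentiable (at t)"
    by (auto simp: differentiable_def)
qed

end

section \<open>Transport of fields along an orbit to its initial point\<close>

context atlas_flow
begin

text \<open>The derivative found for each vector depends on a choice of \<open>D\<close>; uniqueness
  of derivatives identifies it with the operator-valued derivative, whose continuity is then checked
  vector by vector.\<close>

lemma jac_C1:
  assumes "c \<in> A" "d \<in> A" "p \<in> cdom c"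
  shows "(\<lambda>t. jac f c d t p) C1_differentiable_on {t. f t p \<in> cdom d}"
proof -
  let ?S = "{t. f t p \<in> cdom d}"
  let ?L = "\<lambda>t. jac f c d t p"
  let ?V = "\<lambda>t. vector_derivative ?L (at t)"
  have V: "(?L has_vector_derivative ?V t) (at t)" if "t \<in> ?S" for t
  proof -
    have "?L differentiable (at t)"
    proof (rule differentiable_blinfunI)
      fix u
      obtain D where "\<And>t. f t p \<in> cdom d \<Longrightarrow> ((\<lambda>t. ?L t u) has_vector_derivative D t) (at t)"
        using jac_time_deriv[OF assms] by metis
      then show "(\<lambda>t. ?L t u) differentiable (at t)"
        using that by (auto intro: differentiableI_vector)
    qed
    then show ?thesis
      by (simp add: vector_derivative_works)
  qed
  moreover have "continuous_on ?S ?V"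
  proof (rule continuous_on_blinfun_componentwise)
    fix u
    obtain D where D: "\<And>t. f t p \<in> cdom d \<Longrightarrow> ((\<lambda>t. ?L t u) has_vector_derivative D t) (at t)"
      and "continuous_on ?S D"
      using jac_time_deriv[OF assms] by metis
    moreover have "D t = ?V t u" if "t \<in> ?S" for t
      using bounded_linear.has_vector_derivative[OF blinfun.bounded_linear_left V[OF that]] D that
      by (auto intro: vector_derivative_unique_at)
    ultimately show "continuous_on ?S (\<lambda>t. ?V t u)"
      by (blast intro: continuous_on_eq)
  qed
  ultimately show ?thesis
    unfolding C1_differentiable_on_def by (intro exI[of _ ?V] conjI ballI)
qed

lemma to_of_chart [simp]:
  assumes "c \<in> A" "p \<in> cdom c"
  shows "to_chart A c p o\<^sub>L of_chart A c p = id_blinfun" "of_chart A c p o\<^sub>L to_chart A c p = id_blinfun"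
  using jac_compose[of c "chart_at A p" c p 0 0] jac_compose[of "chart_at A p" c "chart_at A p" p 0 0] assms
  by (simp_all add: to_chart_jac of_chart_jac jac_id)

lemma to_of_chart_apply [simp]:
  assumes "c \<in> A" "p \<in> cdom c"
  shows "to_chart A c p (of_chart A c p u) = u" "of_chart A c p (to_chart A c p u) = u"
  using to_of_chart[OF assms] by (metis blinfun_apply_blinfun_compose blinfun_apply_id_blinfun id_apply)+

end

locale flow_orbit = atlas_flow A F f
  for A :: "('m::{t2_space,second_countable_topology}, 'e::euclidean_space) chart set"
    and F :: "'m \<Rightarrow> 'e" and f :: "real \<Rightarrow> 'm \<Rightarrow> 'm" +
  fixes x :: "real \<Rightarrow> 'm" and x0 :: 'm
  assumes orbit: "x = orbit f x0"
begin

lemma x_eq: "x t = f t x0"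
  by (simp add: orbit orbit_def)

lemma flow_x: "f s (x t) = x (s + t)"
  by (simp add: x_eq flow_add)

definition Phi :: "real \<Rightarrow> 'e \<Rightarrow>\<^sub>L 'e" where "Phi t = pushforward A (f t) x0"

text \<open>Introduced as a tangent map rather than as an inverse operator, so that it is itself a
  jacobian and obeys the same cocycle rule as \<open>Phi\<close>.\<close>

definition Psi :: "real \<Rightarrow> 'e \<Rightarrow>\<^sub>L 'e" where "Psi t = pushforward A (f (- t)) (x t)"

lemma Psi_jac: "Psi t = jac f (chart_at A (x t)) (chart_at A x0) (- t) (x t)"
  by (simp add: Psi_def pushforward_jac flow_x) (simp add: x_eq)

lemma Phi_jac: "Phi t = jac f (chart_at A x0) (chart_at A (x t)) t x0"
  by (simp add: Phi_def pushforward_jac x_eq)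

lemma pushforward_compose_Phi: "pushforward A (f s) (x t) o\<^sub>L Phi t = Phi (s + t)"
  using jac_compose[of "chart_at A x0" "chart_at A (x t)" "chart_at A (x (s + t))" x0 t s]
  by (simp add: Phi_jac pushforward_jac flow_x) (simp add: x_eq)

lemma Psi_compose_Phi [simp]: "Psi t o\<^sub>L Phi t = id_blinfun"
  using pushforward_compose_Phi[of "- t" t] by (simp add: Psi_def Phi_jac x_eq jac_id)

lemma Phi_compose_Psi [simp]: "Phi t o\<^sub>L Psi t = id_blinfun"
  using jac_compose[of "chart_at A (x t)" "chart_at A x0" "chart_at A (x t)" "x t" "- t" t]
  by (simp add: Phi_jac Psi_jac flow_x jac_id) (simp add: x_eq jac_id)

lemma Phi_Psi [simp]: "Phi t (Psi t u) = u" "Psi t (Phi t u) = u"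
  by (metis Phi_compose_Psi Psi_compose_Phi blinfun_apply_blinfun_compose blinfun_apply_id_blinfun id_apply)+

lemma eq_compose_Psi_iff: "L = M o\<^sub>L Psi t \<longleftrightarrow> L o\<^sub>L Phi t = M"
  by (auto simp: blinfun_compose_assoc)

text \<open>Every tangent map along the orbit factors through the tangent space at
  \<open>x0\<close>. This is what turns pullbacks in Lie derivatives and in the expansion formula
  into fixed linear maps applied to transported curves.\<close>

lemma pushforward_orbit: "pushforward A (f s) (x t) = Phi (s + t) o\<^sub>L Psi t"
  by (simp add: blinfun_compose_assoc flip: pushforward_compose_Phi)

text \<open>The possibly jumping preferred chart at \<open>x t\<close> cancels, leaving a jacobian
  between two fixed charts.\<close>

lemma to_chart_Phi:
  assumes "c \<in> A" "x t \<in> cdom c"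
  shows "to_chart A c (x t) o\<^sub>L Phi t = jac f (chart_at A x0) c t x0"
  using jac_compose[of "chart_at A x0" "chart_at A (x t)" c x0 t 0] assms
  by (simp add: Phi_jac to_chart_jac x_eq)

lemma Psi_of_chart:
  assumes "c \<in> A" "x t \<in> cdom c"
  shows "Psi t o\<^sub>L of_chart A c (x t) = jac f c (chart_at A x0) (- t) (x t)"
  using jac_compose[of c "chart_at A (x t)" "chart_at A x0" "x t" 0 "- t"] assms
  by (simp add: Psi_jac of_chart_jac flow_x) (simp add: x_eq)

lemma open_orbit_times: "c \<in> A \<Longrightarrow> open {t. x t \<in> cdom c}"
  by (simp add: x_eq open_times)

lemma to_chart_Phi_C1:
  assumes "c \<in> A"
  shows "(\<lambda>t. jac f (chart_at A x0) c t x0) C1_differentiable_on {t. x t \<in> cdom c}"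
  using jac_C1[of "chart_at A x0" c x0] assms by (simp add: x_eq)

lemma Psi_of_chart_differentiable:
  assumes "c \<in> A" "x t \<in> cdom c"
  shows "(\<lambda>s. jac f c (chart_at A x0) (- s) (x s)) differentiable (at t)"
  using jac_backward_differentiable[of c "chart_at A x0" x0 t] assms by (simp add: x_eq)

section \<open>Regularity of transported fields\<close>

lemma local_continuous:
  assumes "\<And>t. continuous_on {s. x s \<in> cdom (chart_at A (x t))} h"
  shows "continuous_on UNIV h"
proof (rule continuous_at_imp_continuous_on, rule ballI)
  fix t
  show "isCont h t"
    using assms[of t] open_orbit_times[of "chart_at A (x t)"] by (auto simp: continuous_on_eq_continuous_at)
qed

text \<open>Between \<omega> and \<open>Phi\<close> one inserts the identity
  \<open>of_chart o to_chart\<close> of a chart held fixed near \<tau>; each of the two resulting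
  factors is continuous.\<close>

lemma transported_covfield_continuous:
  assumes "\<forall>c\<in>A. continuous_on {t. x t \<in> cdom c} (\<lambda>t. \<omega> t o\<^sub>L of_chart A c (x t))"
  shows "continuous_on UNIV (\<lambda>t. \<omega> t o\<^sub>L Phi t)"
proof (rule local_continuous)
  fix \<tau>
  let ?c = "chart_at A (x \<tau>)"
  let ?S = "{t. x t \<in> cdom ?c}"
  have "continuous_on ?S (\<lambda>t. (\<omega> t o\<^sub>L of_chart A ?c (x t)) o\<^sub>L jac f (chart_at A x0) ?c t x0)"
    by (rule bounded_bilinear.continuous_on[OF bounded_bilinear_blinfun_compose])
      (use assms C1_differentiable_imp_continuous_on[OF to_chart_Phi_C1[of ?c]] in auto)
  moreover have "(\<omega> t o\<^sub>L of_chart A ?c (x t)) o\<^sub>L jac f (chart_at A x0) ?c t x0 = \<omega> t o\<^sub>L Phi t"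
    if "t \<in> ?S" for t
    using that by (intro blinfun_eqI) (simp flip: to_chart_Phi)
  ultimately show "continuous_on ?S (\<lambda>t. \<omega> t o\<^sub>L Phi t)"
    by (rule continuous_on_eq)
qed

lemma transported_vfield_continuous:
  assumes "\<forall>c\<in>A. continuous_on {t. x t \<in> cdom c} (\<lambda>t. to_chart A c (x t) (v t))"
  shows "continuous_on UNIV (\<lambda>t. Psi t (v t))"
proof (rule local_continuous)
  fix \<tau>
  let ?c = "chart_at A (x \<tau>)"
  let ?S = "{t. x t \<in> cdom ?c}"
  have "continuous_on ?S (\<lambda>t. jac f ?c (chart_at A x0) (- t) (x t) (to_chart A ?c (x t) (v t)))"
    by (rule blinfun.continuous_on)
      (use assms Psi_of_chart_differentiable[of ?c] in
        \<open>auto intro!: continuous_at_imp_continuous_on differentiable_imp_continuous_within\<close>)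
  moreover have "jac f ?c (chart_at A x0) (- t) (x t) (to_chart A ?c (x t) (v t)) = Psi t (v t)"
    if "t \<in> ?S" for t
    using that by (simp flip: Psi_of_chart)
  ultimately show "continuous_on ?S (\<lambda>t. Psi t (v t))"
    by (rule continuous_on_eq)
qed

lemma differentiable_covfield_iff:
  "differentiable_covfield A x \<nu> \<longleftrightarrow> (\<forall>t. (\<lambda>s. \<nu> s o\<^sub>L Phi s) differentiable (at t))"
proof
  assume nu: "differentiable_covfield A x \<nu>"
  show "\<forall>t. (\<lambda>s. \<nu> s o\<^sub>L Phi s) differentiable (at t)"
  proof
    fix t
    let ?c = "chart_at A (x t)"
    have "(\<lambda>s. (\<nu> s o\<^sub>L of_chart A ?c (x s)) o\<^sub>L jac f (chart_at A x0) ?c s x0) differentiable (at t)"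
      by (rule differentiable_blinfun_compose)
        (use nu C1_differentiable_at[OF to_chart_Phi_C1[of ?c], of t] in
          \<open>auto simp: differentiable_covfield_def\<close>)
    then show "(\<lambda>s. \<nu> s o\<^sub>L Phi s) differentiable (at t)"
      by (rule differentiable_transform_open[OF _ open_orbit_times[of ?c]])
        (auto intro!: blinfun_eqI simp flip: to_chart_Phi)
  qed
next
  assume nu: "\<forall>t. (\<lambda>s. \<nu> s o\<^sub>L Phi s) differentiable (at t)"
  show "differentiable_covfield A x \<nu>"
    unfolding differentiable_covfield_def
  proof (intro ballI allI impI)
    fix c t assume c: "c \<in> A" "x t \<in> cdom c"
    have "(\<lambda>s. (\<nu> s o\<^sub>L Phi s) o\<^sub>L jac f c (chart_at A x0) (- s) (x s)) differentiable (at t)"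
      by (rule differentiable_blinfun_compose) (use nu Psi_of_chart_differentiable[OF c] in auto)
    then show "(\<lambda>s. \<nu> s o\<^sub>L of_chart A c (x s)) differentiable (at t)"
      by (rule differentiable_transform_open[OF _ open_orbit_times[OF c(1)]])
        (use c in \<open>auto intro!: blinfun_eqI simp flip: Psi_of_chart\<close>)
  qed
qed

lemma transported_C1_vfield_differentiable:
  assumes "\<forall>c\<in>A. (\<lambda>t. to_chart A c (x t) (v t)) C1_differentiable_on {t. x t \<in> cdom c}"
  shows "(\<lambda>s. Psi s (v s)) differentiable (at t)"
proof -
  let ?c = "chart_at A (x t)"
  have "(\<lambda>s. jac f ?c (chart_at A x0) (- s) (x s) (to_chart A ?c (x s) (v s))) differentiable (at t)"
    by (rule differentiable_blinfun_apply)
      (use assms Psi_of_chart_differentiable[of ?c t] in \<open>auto intro: C1_differentiable_at\<close>)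
  then show ?thesis
    by (rule differentiable_transform_open[OF _ open_orbit_times[of ?c]])
      (auto simp flip: Psi_of_chart)
qed

text \<open>Product rule. Here the jacobian must be C^1 and not just differentiable, because its
  derivative occurs in the derivative of the field, which has to be continuous.\<close>

lemma C1_vfield_of_transported:
  assumes "c \<in> A" and w: "\<And>t. (w has_vector_derivative w' t) (at t)" "continuous_on UNIV w'"
  shows "(\<lambda>t. to_chart A c (x t) (Phi t (w t))) C1_differentiable_on {t. x t \<in> cdom c}"
proof -
  let ?S = "{t. x t \<in> cdom c}"
  let ?J = "\<lambda>t. jac f (chart_at A x0) c t x0"
  have eq: "?J t (w t) = to_chart A c (x t) (Phi t (w t))" if "t \<in> ?S" for t
    using that assms(1) by (simp flip: to_chart_Phi)
  obtain D where D: "\<And>t. t \<in> ?S \<Longrightarrow> (?J has_vector_derivative D t) (at t)" "continuous_on ?S D"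
    using to_chart_Phi_C1[OF assms(1)] unfolding C1_differentiable_on_def by blast
  have deriv: "((\<lambda>t. to_chart A c (x t) (Phi t (w t))) has_vector_derivative
      ?J t (w' t) + D t (w t)) (at t)" if "t \<in> ?S" for t
    by (rule has_vector_derivative_transform_within_open[OF _ open_orbit_times[OF assms(1)] that eq])
      (rule bounded_bilinear.has_vector_derivative[OF bounded_bilinear_blinfun_apply D(1)[OF that] w(1)])
  have "continuous_on ?S w" "continuous_on ?S w'"
    using continuous_on_subset[OF w(2)] w(1)
    by (auto intro!: continuous_at_imp_continuous_on has_vector_derivative_continuous)
  then have "continuous_on ?S (\<lambda>t. ?J t (w' t) + D t (w t))"
    using D(2) C1_differentiable_imp_continuous_on[OF to_chart_Phi_C1[OF assms(1)]]
    by (intro continuous_on_add blinfun.continuous_on)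
  with deriv show ?thesis
    unfolding C1_differentiable_on_def by (intro exI conjI ballI)
qed

text \<open>The curve differentiated in \<open>lie_cov\<close> is the transported curve followed by
  the constant linear map of composition with \<open>Psi \<tau>\<close>.\<close>

lemma lie_cov_transported:
  assumes "((\<lambda>t. \<nu> t o\<^sub>L Phi t) has_vector_derivative d) (at \<tau>)"
  shows "lie_cov A f x \<nu> \<tau> = d o\<^sub>L Psi \<tau>"
proof -
  have "((\<lambda>t. (\<nu> (\<tau> + t) o\<^sub>L Phi (\<tau> + t)) o\<^sub>L Psi \<tau>) has_vector_derivative d o\<^sub>L Psi \<tau>) (at 0)"
    using assms
    by (intro bounded_linear.has_vector_derivative[OF
          bounded_bilinear.bounded_linear_left[OF bounded_bilinear_blinfun_compose]])
      (rule has_vector_derivative_translate)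
  moreover have "(\<nu> (\<tau> + t) o\<^sub>L Phi (\<tau> + t)) o\<^sub>L Psi \<tau> = pullback A (f t) (x \<tau>) (\<nu> (\<tau> + t))" for t
    by (simp add: pullback_def pushforward_orbit blinfun_compose_assoc add.commute)
  ultimately show ?thesis
    by (simp add: lie_cov_def vector_derivative_at)
qed

lemma lie_vec_transported:
  assumes "((\<lambda>t. Psi t (v t)) has_vector_derivative d) (at \<tau>)"
  shows "lie_vec A f x v \<tau> = Phi \<tau> d"
proof -
  have "((\<lambda>t. Phi \<tau> (Psi (\<tau> + t) (v (\<tau> + t)))) has_vector_derivative Phi \<tau> d) (at 0)"
    using assms
    by (intro bounded_linear.has_vector_derivative[OF blinfun.bounded_linear_right])
      (rule has_vector_derivative_translate)
  moreover have "Phi \<tau> (Psi (\<tau> + t) u) = pushforward A (f (- t)) (x (\<tau> + t)) u" for t u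
    by (simp add: pushforward_orbit)
  ultimately show ?thesis
    by (simp add: lie_vec_def vector_derivative_at)
qed

lemma Phi_F: "Phi t (F x0) = F (x t)"
  by (simp add: Phi_def pushforward_F x_eq)

end

section \<open>Riemannian norms\<close>

text \<open>Only pointwise convergence of the forms is assumed; since a form is determined by
  finitely many coefficients, the convergence is uniform on the unit sphere.\<close>

lemma eventually_bilinear_form_equivalent:
  fixes G :: "'t \<Rightarrow> 'e::euclidean_space \<Rightarrow> 'e \<Rightarrow> real"
  assumes bil: "\<And>y. bilinear (G y)" "bilinear H"
    and pos: "\<And>u. u \<noteq> 0 \<Longrightarrow> H u u > 0"
    and lim: "\<And>u w. ((\<lambda>y. G y u w) \<longlongrightarrow> H u w) \<F>"
  shows "\<exists>m>0. \<exists>M>0. \<forall>\<^sub>F y in \<F>. \<forall>u. m * (norm u)\<^sup>2 \<le> G y u u \<and> G y u u \<le> M * (norm u)\<^sup>2"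
proof -
  have "continuous_on (sphere 0 1) (\<lambda>u. H u u)"
    using bil(2) by (intro bounded_bilinear.continuous_on[of H] continuous_on_id)
      (simp add: bilinear_conv_bounded_bilinear)
  moreover have "sphere 0 1 \<noteq> ({} :: 'e set)"
    by simp
  ultimately obtain e where e: "e \<in> sphere 0 1" "\<And>u. u \<in> sphere 0 1 \<Longrightarrow> H e e \<le> H u u"
    using continuous_attains_inf[OF compact_sphere] by blast
  define m where "m = H e e"
  have m: "m > 0"
    using pos[of e] e(1) unfolding m_def by force
  have H_lower: "m * (norm u)\<^sup>2 \<le> H u u" for u
  proof (cases "u = 0")
    case False
    then have "m \<le> H (u /\<^sub>R norm u) (u /\<^sub>R norm u)"
      unfolding m_def by (intro e(2)) simp
    also have "\<dots> = H u u / (norm u)\<^sup>2"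
      by (simp add: bilinear_lmul[OF bil(2)] bilinear_rmul[OF bil(2)] power2_eq_square divide_simps)
    finally show ?thesis
      using False by (simp add: field_simps)
  qed (simp add: bilinear_lzero[OF bil(2)])
  obtain B where B: "B > 0" "\<And>u. H u u \<le> B * (norm u)\<^sup>2"
    using bilinear_bounded_pos[OF bil(2)] by (metis abs_le_D1 mult.assoc power2_eq_square real_norm_def)
  \<comment> \<open>The total coefficient error controls the difference of the quadratic forms for
    all \<open>u\<close> at once; once it is below m / 2, half of the lower bound survives.\<close>
  define d where "d y = (\<Sum>i\<in>Basis. \<Sum>j\<in>Basis. \<bar>G y i j - H i j\<bar>)" for y
  have diff: "\<bar>G y u u - H u u\<bar> \<le> d y * (norm u)\<^sup>2" for y u
  proof -
    have expand: "Q u u = (\<Sum>(i, j)\<in>Basis \<times> Basis. (u \<bullet> i) * (u \<bullet> j) * Q i j)"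
      if "bilinear Q" for Q :: "'e \<Rightarrow> 'e \<Rightarrow> real"
    proof -
      have "Q u u = Q (\<Sum>i\<in>Basis. (u \<bullet> i) *\<^sub>R i) (\<Sum>i\<in>Basis. (u \<bullet> i) *\<^sub>R i)"
        by (simp add: euclidean_representation)
      also have "\<dots> = (\<Sum>(i, j)\<in>Basis \<times> Basis. Q ((u \<bullet> i) *\<^sub>R i) ((u \<bullet> j) *\<^sub>R j))"
        by (rule bilinear_sum[OF that])
      also have "\<dots> = (\<Sum>(i, j)\<in>Basis \<times> Basis. (u \<bullet> i) * (u \<bullet> j) * Q i j)"
        by (simp add: bilinear_lmul[OF that] bilinear_rmul[OF that] mult_ac)
      finally show ?thesis .
    qed
    have "G y u u - H u u = (\<Sum>(i, j)\<in>Basis \<times> Basis. (u \<bullet> i) * (u \<bullet> j) * (G y i j - H i j))"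
      unfolding expand[OF bil(1)] expand[OF bil(2)] sum_subtractf[symmetric]
      by (intro sum.cong) (auto simp: algebra_simps)
    also have "\<bar>\<dots>\<bar> \<le> (\<Sum>(i, j)\<in>Basis \<times> Basis. (norm u)\<^sup>2 * \<bar>G y i j - H i j\<bar>)"
    proof (rule order_trans[OF sum_abs sum_mono], clarsimp simp: abs_mult)
      fix i j :: 'e assume "i \<in> Basis" "j \<in> Basis"
      then have "\<bar>u \<bullet> i\<bar> * \<bar>u \<bullet> j\<bar> \<le> norm u * norm u"
        by (intro mult_mono Basis_le_norm) auto
      then show "\<bar>u \<bullet> i\<bar> * \<bar>u \<bullet> j\<bar> * \<bar>G y i j - H i j\<bar> \<le> (norm u)\<^sup>2 * \<bar>G y i j - H i j\<bar>"
        by (intro mult_right_mono) (auto simp: power2_eq_square)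
    qed
    also have "\<dots> = d y * (norm u)\<^sup>2"
      by (simp add: d_def sum.cartesian_product sum_distrib_right sum_distrib_left case_prod_unfold mult.commute)
    finally show ?thesis .
  qed
  have "(d \<longlongrightarrow> (\<Sum>i\<in>Basis. \<Sum>j\<in>Basis. \<bar>H i j - H i j\<bar>)) \<F>"
    unfolding d_def by (intro tendsto_intros lim)
  then have "\<forall>\<^sub>F y in \<F>. d y < m / 2"
    using m by (intro order_tendstoD) auto
  then have "\<forall>\<^sub>F y in \<F>. \<forall>u. m / 2 * (norm u)\<^sup>2 \<le> G y u u \<and> G y u u \<le> (B + m / 2) * (norm u)\<^sup>2"
  proof eventually_elim
    case (elim y)
    show ?case
    proof
      fix u :: 'e
      have "d y * (norm u)\<^sup>2 \<le> m / 2 * (norm u)\<^sup>2"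
        using elim by (intro mult_right_mono) auto
      then have "G y u u - H u u \<le> m / 2 * (norm u)\<^sup>2" "H u u - G y u u \<le> m / 2 * (norm u)\<^sup>2"
        using diff[of y u] by linarith+
      with H_lower[of u] B(2)[of u]
      show "m / 2 * (norm u)\<^sup>2 \<le> G y u u \<and> G y u u \<le> (B + m / 2) * (norm u)\<^sup>2"
        by (simp add: distrib_right)
    qed
  qed
  with m B(1) show ?thesis
    by (intro exI[of _ "m / 2"] exI[of _ "B + m / 2"] conjI) auto
qed

text \<open>A finite subcover leaves finitely many constants, which monotonicity in the bound allows
  to be replaced by one larger constant.\<close>

lemma compact_uniform_bound:
  fixes Q :: "real \<Rightarrow> 'm::topological_space \<Rightarrow> bool"
  assumes "compact K" and mono: "\<And>B B' q. Q B q \<Longrightarrow> B \<le> B' \<Longrightarrow> Q B' q"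
    and loc: "\<And>p. p \<in> K \<Longrightarrow> \<exists>B. \<forall>\<^sub>F q in nhds p. q \<in> K \<longrightarrow> Q B q"
  obtains B where "\<And>q. q \<in> K \<Longrightarrow> Q B q"
proof -
  have "\<exists>W B. open W \<and> p \<in> W \<and> (\<forall>q\<in>W. q \<in> K \<longrightarrow> Q B q)" if "p \<in> K" for p
    using loc[OF that] by (auto simp: eventually_nhds)
  then obtain W B where W: "\<And>p. p \<in> K \<Longrightarrow> open (W p) \<and> p \<in> W p \<and> (\<forall>q\<in>W p. q \<in> K \<longrightarrow> Q (B p) q)"
    by metis
  then have "K \<subseteq> (\<Union>p\<in>K. W p)"
    by blast
  then obtain C where C: "C \<subseteq> K" "finite C" "K \<subseteq> (\<Union>p\<in>C. W p)"
    using compactE_image[OF \<open>compact K\<close>, of K W] W by blast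
  show thesis
  proof
    fix q assume "q \<in> K"
    then obtain p where p: "p \<in> C" "q \<in> W p"
      using C by blast
    have "B p \<le> (\<Sum>r\<in>C. \<bar>B r\<bar>)"
      using member_le_sum[of p C "\<lambda>r. \<bar>B r\<bar>"] C p by auto
    then show "Q (\<Sum>r\<in>C. \<bar>B r\<bar>) q"
      using mono W C p \<open>q \<in> K\<close> by blast
  qed
qed

locale riemannian_flow = atlas_flow A F f
  for A :: "('m::{t2_space,second_countable_topology}, 'e::euclidean_space) chart set"
    and F :: "'m \<Rightarrow> 'e" and f :: "real \<Rightarrow> 'm \<Rightarrow> 'm" +
  fixes g :: "'m \<Rightarrow> 'e \<Rightarrow> 'e \<Rightarrow> real"
  assumes metric: "riemannian_metric A g"
begin

lemma bilinear_g: "bilinear (g p)" and sym_g: "g p u w = g p w u"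
  and pos_g: "u \<noteq> 0 \<Longrightarrow> g p u u > 0"
  using metric by (auto simp: riemannian_metric_def)

lemma g_self_nonneg: "g p u u \<ge> 0"
  using pos_g[of u p] bilinear_lzero[OF bilinear_g, of p u] by (cases "u = 0") auto

lemma rnorm_nonneg [simp]: "rnorm g p u \<ge> 0"
  by (simp add: rnorm_def g_self_nonneg)

lemma rnorm_sq: "(rnorm g p u)\<^sup>2 = g p u u"
  by (simp add: rnorm_def g_self_nonneg)

lemma Cauchy_Schwarz_g: "g p u w \<le> rnorm g p u * rnorm g p w"
proof (cases "w = 0")
  case True
  then show ?thesis
    by (simp add: bilinear_rzero[OF bilinear_g])
next
  case False
  note bil = bilinear_lsub[OF bilinear_g] bilinear_rsub[OF bilinear_g]
    bilinear_lmul[OF bilinear_g] bilinear_rmul[OF bilinear_g]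
  have w: "g p w w > 0"
    using False by (rule pos_g)
  \<comment> \<open>The coefficient of the orthogonal projection of \<open>u\<close> onto
    \<open>w\<close>, which minimizes the length of u - r w.\<close>
  define r where "r = g p u w / g p w w"
  have "0 \<le> g p (u - r *\<^sub>R w) (u - r *\<^sub>R w)"
    by (rule g_self_nonneg)
  also have "\<dots> = g p u u - (g p u w)\<^sup>2 / g p w w"
    using w by (simp add: bil r_def sym_g[of p w u] power2_eq_square field_simps)
  finally have "(g p u w)\<^sup>2 \<le> (rnorm g p u * rnorm g p w)\<^sup>2"
    using w by (simp add: power_mult_distrib rnorm_sq field_simps)
  then show ?thesis
    by (rule power2_le_imp_le) simp
qed

lemma rnorm_minus: "rnorm g p (- u) = rnorm g p u"
  by (simp add: rnorm_def bilinear_lneg[OF bilinear_g] bilinear_rneg[OF bilinear_g])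

lemma rnorm_scaleR: "rnorm g p (r *\<^sub>R u) = \<bar>r\<bar> * rnorm g p u"
  by (simp add: rnorm_def bilinear_lmul[OF bilinear_g] bilinear_rmul[OF bilinear_g]
      real_sqrt_mult flip: mult.assoc)

text \<open>A bound by duality, which turns estimates of vector integrals into estimates of real ones.\<close>
lemma rnorm_le_dual:
  assumes "\<And>w. g p w u \<le> B * rnorm g p w"
  shows "rnorm g p u \<le> B"
proof (cases "rnorm g p u = 0")
  case True
  then have "u = 0"
    using pos_g[of u p] rnorm_sq[of p u] by force
  \<comment> \<open>The claim is now 0 <= B, which the hypothesis yields only when tested on a
    nonzero vector.\<close>
  obtain w :: 'e where "w \<noteq> 0"
    using nonzero_Basis nonempty_Basis by blast
  then have "rnorm g p w > 0"
    using pos_g[of w p] by (simp add: rnorm_def)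
  moreover have "0 \<le> B * rnorm g p w"
    using assms[of w] \<open>u = 0\<close> by (simp add: bilinear_rzero[OF bilinear_g])
  ultimately show ?thesis
    using True by (simp add: zero_le_mult_iff)
next
  case False
  then have "rnorm g p u > 0"
    using rnorm_nonneg[of p u] by linarith
  moreover have "rnorm g p u * rnorm g p u \<le> B * rnorm g p u"
    using assms[of u] rnorm_sq[of p u] by (simp add: power2_eq_square)
  ultimately show ?thesis
    by simp
qed

lemma rnorm_diff_le: "rnorm g p (u - v) \<le> rnorm g p u + rnorm g p v"
proof (rule rnorm_le_dual)
  fix w
  have "g p w (u - v) = g p w u + g p w (- v)"
    by (simp add: bilinear_rsub[OF bilinear_g] bilinear_rneg[OF bilinear_g])
  also have "\<dots> \<le> (rnorm g p u + rnorm g p v) * rnorm g p w"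
    using Cauchy_Schwarz_g[of p w u] Cauchy_Schwarz_g[of p w "- v"]
    by (simp add: rnorm_minus algebra_simps)
  finally show "g p w (u - v) \<le> (rnorm g p u + rnorm g p v) * rnorm g p w" .
qed

text \<open>A fixed chart provides one coordinate space in which the metrics at all nearby points
  are compared with common constants; such local constants are what compactness of K needs.\<close>

lemma rnorm_equivalent_in_chart:
  assumes c: "c \<in> A" "p \<in> cdom c"
  obtains m M where "m > 0" "M > 0"
    "\<forall>\<^sub>F q in nhds p. \<forall>u. m * norm (to_chart A c q u) \<le> rnorm g q u \<and>
       rnorm g q u \<le> M * norm (to_chart A c q u)"
proof -
  let ?G = "\<lambda>q u w. g q (of_chart A c q u) (of_chart A c q w)"
  have in_dom: "\<forall>\<^sub>F q in nhds p. q \<in> cdom c"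
    using chart[OF c(1)] c(2) by (auto simp: is_chart_def eventually_nhds)
  have bil: "bilinear (?G q)" for q
    by (simp add: bilinear_def linear_iff bilinear_ladd[OF bilinear_g] bilinear_radd[OF bilinear_g]
        bilinear_lmul[OF bilinear_g] bilinear_rmul[OF bilinear_g] blinfun.add_right blinfun.scaleR_right)
  have pos: "?G p u u > 0" if "u \<noteq> 0" for u
    using that to_of_chart_apply[OF c] by (intro pos_g) (metis blinfun.zero_right)
  have lim: "((\<lambda>q. ?G q u w) \<longlongrightarrow> ?G p u w) (nhds p)" for u w
  proof -
    have "Ck_on 0 (cmap c ` cdom c) (\<lambda>y. metric_in_chart A g c y u w)"
      using metric c by (simp add: riemannian_metric_def smooth_on_def del: Ck_on.simps)
    then have "continuous_on (cdom c) (\<lambda>q. metric_in_chart A g c (cmap c q) u w)"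
      using continuous_on_compose2[OF _ continuous_on_cmap[OF chart[OF c(1)]]] by auto
    then have "continuous_on (cdom c) (\<lambda>q. ?G q u w)"
      by (rule continuous_on_eq) (simp add: metric_in_chart_def c(1))
    then have "isCont (\<lambda>q. ?G q u w) p"
      using chart[OF c(1)] c(2) by (simp add: is_chart_def continuous_on_eq_continuous_at)
    then show ?thesis
      by (simp add: isCont_def tendsto_at_iff_tendsto_nhds[of "\<lambda>q. ?G q u w"])
  qed
  obtain m M where m: "m > 0" "M > 0"
    and ev: "\<forall>\<^sub>F q in nhds p. \<forall>u. m * (norm u)\<^sup>2 \<le> ?G q u u \<and> ?G q u u \<le> M * (norm u)\<^sup>2"
    using eventually_bilinear_form_equivalent[of ?G "?G p", OF bil bil pos lim] by blast
  have "\<forall>\<^sub>F q in nhds p. \<forall>u. sqrt m * norm (to_chart A c q u) \<le> rnorm g q u \<and>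
       rnorm g q u \<le> sqrt M * norm (to_chart A c q u)"
    using ev in_dom
  proof eventually_elim
    case (elim q)
    show ?case
    proof
      fix u
      have "m * (norm (to_chart A c q u))\<^sup>2 \<le> g q u u \<and> g q u u \<le> M * (norm (to_chart A c q u))\<^sup>2"
        using elim(1)[rule_format, of "to_chart A c q u"] elim(2) c(1) by simp
      then have "sqrt (m * (norm (to_chart A c q u))\<^sup>2) \<le> rnorm g q u"
        "rnorm g q u \<le> sqrt (M * (norm (to_chart A c q u))\<^sup>2)"
        unfolding rnorm_def by (simp_all only: real_sqrt_le_iff)
      then show "sqrt m * norm (to_chart A c q u) \<le> rnorm g q u \<and>
          rnorm g q u \<le> sqrt M * norm (to_chart A c q u)"
        by (simp add: real_sqrt_mult)
    qed
  qed
  with m show thesis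
    using that[of "sqrt m" "sqrt M"] by simp
qed

lemma rnorm_equivalent:
  obtains m M where "m > 0" "M > 0" "\<And>u. m * norm u \<le> rnorm g p u" "\<And>u. rnorm g p u \<le> M * norm u"
proof -
  let ?c = "chart_at A p"
  obtain m M where m: "m > 0" "M > 0"
    "\<forall>\<^sub>F q in nhds p. \<forall>u. m * norm (to_chart A ?c q u) \<le> rnorm g q u \<and>
       rnorm g q u \<le> M * norm (to_chart A ?c q u)"
    by (rule rnorm_equivalent_in_chart[of ?c p]) auto
  moreover have "to_chart A ?c p = id_blinfun"
    by (simp add: to_chart_jac jac_id)
  ultimately show thesis
    using that[of m M] eventually_nhds_x_imp_x[OF m(3)] by simp
qed

section \<open>Uniform bounds over a compact set\<close>

lemma continuous_endo_bounded:
  assumes "compact K" and P: "continuous_endo_on A K P"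
  obtains B where "B > 0" "\<And>p u. p \<in> K \<Longrightarrow> rnorm g p (P p u) \<le> B * rnorm g p u"
proof -
  have loc: "\<exists>B. \<forall>\<^sub>F q in nhds p. q \<in> K \<longrightarrow> (\<forall>u. rnorm g q (P q u) \<le> B * rnorm g q u)" if p: "p \<in> K" for p
  proof -
    let ?c = "chart_at A p"
    let ?T = "\<lambda>q. to_chart A ?c q o\<^sub>L P q o\<^sub>L of_chart A ?c q"
    have in_dom: "\<forall>\<^sub>F q in nhds p. q \<in> cdom ?c"
      using chart[of ?c] by (auto simp: is_chart_def eventually_nhds)
    have "continuous_on (K \<inter> cdom ?c) ?T"
      using P by (simp add: continuous_endo_on_def)
    then have "(?T \<longlongrightarrow> ?T p) (at p within K \<inter> cdom ?c)"
      using p by (simp add: continuous_on_def)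
    then have "((\<lambda>q. norm (?T q)) \<longlongrightarrow> norm (?T p)) (at p within K \<inter> cdom ?c)"
      by (rule tendsto_norm)
    then have "\<forall>\<^sub>F q in at p within K \<inter> cdom ?c. norm (?T q) < norm (?T p) + 1"
      by (rule order_tendstoD) simp
    \<comment> \<open>The punctured filter omits q = p, where the bound holds trivially thanks to
      the added 1.\<close>
    then have T: "\<forall>\<^sub>F q in nhds p. q \<in> K \<inter> cdom ?c \<longrightarrow> norm (?T q) \<le> norm (?T p) + 1"
      unfolding eventually_at_filter by eventually_elim force
    obtain m M where m: "m > 0" "M > 0"
      "\<forall>\<^sub>F q in nhds p. \<forall>u. m * norm (to_chart A ?c q u) \<le> rnorm g q u \<and>
         rnorm g q u \<le> M * norm (to_chart A ?c q u)"
      by (rule rnorm_equivalent_in_chart[of ?c p]) auto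
    have "\<forall>\<^sub>F q in nhds p. q \<in> K \<longrightarrow> (\<forall>u. rnorm g q (P q u) \<le> (M * (norm (?T p) + 1) / m) * rnorm g q u)"
      using T m(3) in_dom
    proof eventually_elim
      case (elim q)
      show ?case
      proof (intro impI allI)
        fix u assume q: "q \<in> K"
        let ?w = "to_chart A ?c q u"
        have "rnorm g q (P q u) \<le> M * norm (?T q ?w)"
          using elim(2)[rule_format, of "P q u"] elim(3) by simp
        also have "norm (?T q ?w) \<le> norm (?T q) * norm ?w"
          by (rule norm_blinfun)
        also have "\<dots> \<le> (norm (?T p) + 1) * (rnorm g q u / m)"
          using elim(1,3) q elim(2)[rule_format, of u] m(1)
          by (intro mult_mono) (auto simp: field_simps)
        finally show "rnorm g q (P q u) \<le> (M * (norm (?T p) + 1) / m) * rnorm g q u"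
          using m(2) by (simp add: field_simps)
      qed
    qed
    then show ?thesis
      by blast
  qed
  have mono: "\<forall>u. rnorm g q (P q u) \<le> B' * rnorm g q u"
    if "\<forall>u. rnorm g q (P q u) \<le> B * rnorm g q u" "B \<le> B'" for B B' q
    using that by (meson mult_right_mono order_trans rnorm_nonneg)
  have "\<exists>B. \<forall>q\<in>K. \<forall>u. rnorm g q (P q u) \<le> B * rnorm g q u"
  proof (rule compact_uniform_bound[where Q = "\<lambda>B q. \<forall>u. rnorm g q (P q u) \<le> B * rnorm g q u",
          OF assms(1) mono loc])
    fix B assume "\<And>q. q \<in> K \<Longrightarrow> \<forall>u. rnorm g q (P q u) \<le> B * rnorm g q u"
    then show ?thesis
      by (intro exI[of _ B] ballI)
  qed
  then obtain B where B: "\<And>q u. q \<in> K \<Longrightarrow> rnorm g q (P q u) \<le> B * rnorm g q u"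
    by blast
  have "rnorm g q (P q u) \<le> (\<bar>B\<bar> + 1) * rnorm g q u" if "q \<in> K" for q u
  proof -
    have "B * rnorm g q u \<le> (\<bar>B\<bar> + 1) * rnorm g q u"
      by (intro mult_right_mono) auto
    with B[OF that] show ?thesis
      by (meson order_trans)
  qed
  then show thesis
    using that[of "\<bar>B\<bar> + 1"] by fastforce
qed

text \<open>Serves to bound the coefficient r by the length of r F. The lower bound is written as 1
  <= B |F| so that it is monotone in B and compactness applies.\<close>

lemma nonvanishing_field_bounded_below:
  assumes "compact K" "smooth_vector_field A F" "\<forall>p\<in>K. F p \<noteq> 0"
  obtains B where "\<And>p. p \<in> K \<Longrightarrow> 1 \<le> B * rnorm g p (F p)"
proof -
  have loc: "\<exists>B. \<forall>\<^sub>F q in nhds p. q \<in> K \<longrightarrow> 1 \<le> B * rnorm g q (F q)" if p: "p \<in> K" for p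
  proof -
    let ?c = "chart_at A p"
    let ?Fc = "\<lambda>q. to_chart A ?c q (F q)"
    have "Ck_on 0 (cmap ?c ` cdom ?c) (\<lambda>y. to_chart A ?c (cinv ?c y) (F (cinv ?c y)))"
      using assms(2) by (simp add: smooth_vector_field_def smooth_on_def del: Ck_on.simps)
    then have "continuous_on (cdom ?c) (\<lambda>q. to_chart A ?c (cinv ?c (cmap ?c q)) (F (cinv ?c (cmap ?c q))))"
      using continuous_on_compose2[OF _ continuous_on_cmap[OF chart]] by fastforce
    then have "continuous_on (cdom ?c) ?Fc"
      by (rule continuous_on_eq) simp
    then have "isCont ?Fc p"
      using chart[of ?c] by (simp add: is_chart_def continuous_on_eq_continuous_at)
    then have "((\<lambda>q. norm (?Fc q)) \<longlongrightarrow> norm (?Fc p)) (nhds p)"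
      using tendsto_at_iff_tendsto_nhds[of ?Fc p] by (simp add: isCont_def tendsto_norm)
    moreover have n: "norm (?Fc p) > 0"
      using assms(3) p by (simp add: to_chart_jac jac_id)
    ultimately have low: "\<forall>\<^sub>F q in nhds p. norm (?Fc q) > norm (?Fc p) / 2"
      by (intro order_tendstoD) auto
    obtain m M where m: "m > 0" "M > 0"
      "\<forall>\<^sub>F q in nhds p. \<forall>u. m * norm (to_chart A ?c q u) \<le> rnorm g q u \<and>
         rnorm g q u \<le> M * norm (to_chart A ?c q u)"
      by (rule rnorm_equivalent_in_chart[of ?c p]) auto
    have "\<forall>\<^sub>F q in nhds p. q \<in> K \<longrightarrow> 1 \<le> (2 / (m * norm (?Fc p))) * rnorm g q (F q)"
      using low m(3)
    proof eventually_elim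
      case (elim q)
      have "m * (norm (?Fc p) / 2) \<le> m * norm (?Fc q)"
        using elim(1) m(1) by (intro mult_left_mono) auto
      also have "\<dots> \<le> rnorm g q (F q)"
        using elim(2) by blast
      finally show ?case
        using m(1) n by (simp add: field_simps)
    qed
    then show ?thesis
      by blast
  qed
  have mono: "1 \<le> B' * rnorm g q (F q)" if "1 \<le> B * rnorm g q (F q)" "B \<le> B'" for B B' q
    using that by (meson mult_right_mono order_trans rnorm_nonneg)
  show thesis
    by (rule compact_uniform_bound[where Q = "\<lambda>B q. 1 \<le> B * rnorm g q (F q)", OF assms(1) mono loc that])
qed

end

section \<open>Projections of a splitting\<close>

text \<open>\<open>proj_along\<close> wraps a definite description in \<open>Blinfun\<close>, so it
  can be evaluated only after uniqueness of the description and linearity of the resulting map are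
  established.\<close>

lemma proj_along_apply:
  fixes V W :: "'e::euclidean_space set"
  assumes V: "subspace V" and W: "subspace W"
    and decomp: "\<And>u. \<exists>a\<in>V. u - a \<in> W" and disj: "V \<inter> W \<subseteq> {0}"
    and "a \<in> V" "u - a \<in> W"
  shows "proj_along V W u = a"
proof -
  have uniq: "a = a'" if "a \<in> V" "u - a \<in> W" "a' \<in> V" "u - a' \<in> W" for u a a'
  proof -
    have "a - a' \<in> W" "a - a' \<in> V"
      using subspace_diff[OF W that(4,2)] subspace_diff[OF V that(1,3)] by simp_all
    then show ?thesis
      using disj by auto
  qed
  define T where "T u = (THE a. a \<in> V \<and> u - a \<in> W)" for u
  have T: "T u = a" if "a \<in> V" "u - a \<in> W" for u a
    unfolding T_def using that uniq by (intro the_equality) blast+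
  have T_in: "T u \<in> V" "u - T u \<in> W" for u
    using decomp[of u] T by auto
  have "linear T"
  proof (rule linearI)
    fix u v :: 'e and r :: real
    have "(u - T u) + (v - T v) \<in> W" "r *\<^sub>R (u - T u) \<in> W"
      using T_in W by (auto intro: subspace_add subspace_scale)
    then show "T (u + v) = T u + T v" "T (r *\<^sub>R u) = r *\<^sub>R T u"
      using T_in V by (auto intro!: T subspace_add subspace_scale simp: algebra_simps)
  qed
  then have "blinfun_apply (proj_along V W) = T"
    by (simp add: proj_along_def T_def[symmetric, abs_def] bounded_linear_Blinfun_apply
        linear_conv_bounded_linear)
  then show ?thesis
    using T assms(5,6) by simp
qed

lemma proj_along_direct_sum3:
  assumes "direct_sum3 V1 V2 V3" "a \<in> V1" "b \<in> V2" "c \<in> V3"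
  shows "proj_along V1 (span (V2 \<union> V3)) (a + b + c) = a"
proof (rule proj_along_apply)
  have sub: "subspace V1" "subspace V2" "subspace V3"
    using assms(1) by (auto simp: direct_sum3_def)
  have W: "span (V2 \<union> V3) = {b + c |b c. b \<in> V2 \<and> c \<in> V3}"
    by (simp add: span_Un span_eq_iff[THEN iffD2] sub)
  show "subspace V1" "subspace (span (V2 \<union> V3))" "a \<in> V1"
    using sub assms by auto
  show "a + b + c - a \<in> span (V2 \<union> V3)"
    unfolding W using assms by (auto simp: algebra_simps)
  show "\<exists>a\<in>V1. u - a \<in> span (V2 \<union> V3)" for u
  proof -
    obtain a b c where "a \<in> V1" "b \<in> V2" "c \<in> V3" "u = a + b + c"
      using assms(1) unfolding direct_sum3_def by blast
    then show ?thesis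
      unfolding W by (intro bexI[of _ a]) auto
  qed
  show "V1 \<inter> span (V2 \<union> V3) \<subseteq> {0}"
  proof
    fix u assume u: "u \<in> V1 \<inter> span (V2 \<union> V3)"
    then obtain b c where bc: "u = b + c" "b \<in> V2" "c \<in> V3"
      unfolding W by blast
    have "u + (- b) + (- c) = 0" "- b \<in> V2" "- c \<in> V3"
      using bc sub by (auto simp: subspace_neg)
    then have "u = 0"
      using assms(1) u unfolding direct_sum3_def by blast
    then show "u \<in> {0}"
      by simp
  qed
qed

lemma direct_sum3_permute:
  assumes "direct_sum3 V1 V2 V3"
  shows "direct_sum3 V2 V1 V3" "direct_sum3 V3 V1 V2"
proof -
  have sub: "subspace V1" "subspace V2" "subspace V3"
    and ex: "\<And>u. \<exists>a\<in>V1. \<exists>b\<in>V2. \<exists>c\<in>V3. u = a + b + c"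
    and un: "\<And>a b c. a \<in> V1 \<Longrightarrow> b \<in> V2 \<Longrightarrow> c \<in> V3 \<Longrightarrow> a + b + c = 0 \<Longrightarrow> a = 0 \<and> b = 0 \<and> c = 0"
    using assms unfolding direct_sum3_def by blast+
  have "\<exists>b\<in>V2. \<exists>a\<in>V1. \<exists>c\<in>V3. u = b + a + c" "\<exists>c\<in>V3. \<exists>a\<in>V1. \<exists>b\<in>V2. u = c + a + b" for u
    using ex[of u] by (metis add.commute add.assoc)+
  moreover have "b = 0 \<and> a = 0 \<and> c = 0" if "a \<in> V1" "b \<in> V2" "c \<in> V3" "b + a + c = 0" for a b c
    using un[of a b c] that by (simp add: add.commute)
  moreover have "c = 0 \<and> a = 0 \<and> b = 0" if "a \<in> V1" "b \<in> V2" "c \<in> V3" "c + a + b = 0" for a b c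
    using un[of a b c] that by (simp add: add.commute add.left_commute)
  ultimately show "direct_sum3 V2 V1 V3" "direct_sum3 V3 V1 V2"
    using sub unfolding direct_sum3_def by simp_all
qed

lemma splitting_projections:
  fixes F :: "'m \<Rightarrow> 'e::euclidean_space"
  assumes ds: "direct_sum3 (Vs p) (Vu p) (span {F p})" and "F p \<noteq> 0"
    and u: "a \<in> Vs p" "b \<in> Vu p"
  shows Ps_apply: "Ps F Vs Vu p (a + b + r *\<^sub>R F p) = a"
    and Pu_apply: "Pu F Vs Vu p (a + b + r *\<^sub>R F p) = b"
    and Pc_apply: "Pc F Vs Vu p (a + b + r *\<^sub>R F p) = r *\<^sub>R F p"
    and eps_c_apply: "eps_c F Vs Vu p (a + b + r *\<^sub>R F p) = r"
proof -
  have span: "r *\<^sub>R F p \<in> span {F p}" for r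
    by (simp add: span_base span_scale)
  have sub: "subspace (Vs p)" "subspace (Vu p)"
    using ds by (auto simp: direct_sum3_def)
  have eq: "span (V \<union> span {F p}) = span (V \<union> {F p})" for V
    by (simp only: span_Un span_span)
  have Pc: "Pc F Vs Vu p (a + b + r *\<^sub>R F p) = r *\<^sub>R F p" if "a \<in> Vs p" "b \<in> Vu p" for a b r
    using proj_along_direct_sum3[OF direct_sum3_permute(2)[OF ds] span[of r] that]
    by (simp add: Pc_def add.commute[of _ "r *\<^sub>R F p"] flip: add.assoc)
  show "Ps F Vs Vu p (a + b + r *\<^sub>R F p) = a"
    using proj_along_direct_sum3[OF ds u span] by (simp add: Ps_def eq)
  show "Pu F Vs Vu p (a + b + r *\<^sub>R F p) = b"
    using proj_along_direct_sum3[OF direct_sum3_permute(1)[OF ds] u(2,1) span[of r]]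
    by (simp add: Pu_def eq add.commute[of b a])
  show "Pc F Vs Vu p (a + b + r *\<^sub>R F p) = r *\<^sub>R F p"
    by (rule Pc[OF u])
  \<comment> \<open>Witness for the description of \<open>eps_c\<close>: the inner product of the
    model space reads r off from r F. The choice of inner product is immaterial, since the values on
    the three summands determine the covector.\<close>
  define e where "e = (1 / (F p \<bullet> F p)) *\<^sub>R (blinfun_inner_right (F p) o\<^sub>L Pc F Vs Vu p)"
  have e: "e (a + b + r *\<^sub>R F p) = r" if "a \<in> Vs p" "b \<in> Vu p" for a b r
    using that assms(2) by (simp add: e_def Pc blinfun.scaleR_left)
  have "eps_c F Vs Vu p = e"
    unfolding eps_c_def
  proof (rule the_equality)
    have "e a = 0" if "a \<in> Vs p" for a
      using e[of a 0 0] that sub by (simp add: subspace_0)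
    moreover have "e b = 0" if "b \<in> Vu p" for b
      using e[of 0 b 0] that sub by (simp add: subspace_0)
    moreover have "e (F p) = 1"
      using e[of 0 0 1] sub by (simp add: subspace_0)
    ultimately show "(\<forall>u\<in>Vs p \<union> Vu p. e u = 0) \<and> e (F p) = 1"
      by blast
  next
    fix e' :: "'e \<Rightarrow>\<^sub>L real"
    assume e': "(\<forall>u\<in>Vs p \<union> Vu p. e' u = 0) \<and> e' (F p) = 1"
    show "e' = e"
    proof (rule blinfun_eqI)
      fix u
      obtain a b c where abc: "a \<in> Vs p" "b \<in> Vu p" "c \<in> span {F p}" "u = a + b + c"
        using ds unfolding direct_sum3_def by blast
      then obtain r where "c = r *\<^sub>R F p"
        by (auto simp: span_singleton)
      then show "e' u = e u"
        using abc e' e[OF abc(1,2)] by (simp add: blinfun.add_right blinfun.scaleR_right)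
    qed
  qed
  then show "eps_c F Vs Vu p (a + b + r *\<^sub>R F p) = r"
    using e[OF u] by simp
qed

section \<open>Hyperbolic orbits\<close>

locale hyperbolic_orbit = riemannian_flow A F f g + flow_orbit A F f x x0
  for A :: "('m::{t2_space,second_countable_topology}, 'e::euclidean_space) chart set"
    and F :: "'m \<Rightarrow> 'e" and f :: "real \<Rightarrow> 'm \<Rightarrow> 'm"
    and g :: "'m \<Rightarrow> 'e \<Rightarrow> 'e \<Rightarrow> real" and x :: "real \<Rightarrow> 'm" and x0 :: 'm +
  fixes K :: "'m set" and Vs Vu :: "'m \<Rightarrow> 'e set"
  assumes hyperbolic: "hyperbolic_attractor A g F f K Vs Vu"
    and smooth_F: "smooth_vector_field A F"
    and F_nonzero_K: "\<forall>p\<in>K. F p \<noteq> 0"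
    and x0_in_K: "x0 \<in> K"
begin

lemmas hyperbolic_conjs = hyperbolic[unfolded hyperbolic_attractor_def]

lemmas compact_K = hyperbolic_conjs[THEN conjunct1]
  and K_invariant = hyperbolic_conjs[THEN conjunct2, THEN conjunct1, rule_format]
  and splitting_K = hyperbolic_conjs[THEN conjunct2, THEN conjunct2, THEN conjunct1, rule_format]
  and continuous_projections =
    hyperbolic_conjs[THEN conjunct2, THEN conjunct2, THEN conjunct2, THEN conjunct1]
    hyperbolic_conjs[THEN conjunct2, THEN conjunct2, THEN conjunct2, THEN conjunct2, THEN conjunct1]
    hyperbolic_conjs[THEN conjunct2, THEN conjunct2, THEN conjunct2, THEN conjunct2, THEN conjunct2,
      THEN conjunct1]
  and splitting_invariant =
    hyperbolic_conjs[THEN conjunct2, THEN conjunct2, THEN conjunct2, THEN conjunct2, THEN conjunct2,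
      THEN conjunct2, THEN conjunct1, rule_format]
  and contraction_K =
    hyperbolic_conjs[THEN conjunct2, THEN conjunct2, THEN conjunct2, THEN conjunct2, THEN conjunct2,
      THEN conjunct2, THEN conjunct2, THEN conjunct1]

lemma x_in_K: "x t \<in> K"
  using imageI[OF x0_in_K, of "f t"] by (simp add: x_eq K_invariant)

lemma F_nonzero: "F (x t) \<noteq> 0"
  using F_nonzero_K x_in_K by blast

lemma x_0 [simp]: "x 0 = x0"
  by (simp add: x_eq)

lemma Phi_0 [simp]: "Phi 0 = id_blinfun"
  by (simp add: Phi_jac jac_id)

lemma Psi_0 [simp]: "Psi 0 = id_blinfun"
  using Psi_compose_Phi[of 0] by simp

lemma splitting: "direct_sum3 (Vs (x t)) (Vu (x t)) (span {F (x t)})"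
  by (rule splitting_K[OF x_in_K])

lemma decompose:
  obtains a b r where "a \<in> Vs (x t)" "b \<in> Vu (x t)" "u = a + b + r *\<^sub>R F (x t)"
proof -
  obtain a b c where "a \<in> Vs (x t)" "b \<in> Vu (x t)" "c \<in> span {F (x t)}" "u = a + b + c"
    using splitting[of t] unfolding direct_sum3_def by blast
  then show thesis
    using that by (auto simp: span_singleton)
qed

lemma Phi_invariant: "u \<in> Vs x0 \<Longrightarrow> Phi t u \<in> Vs (x t)" "u \<in> Vu x0 \<Longrightarrow> Phi t u \<in> Vu (x t)"
  using splitting_invariant[OF x0_in_K, of t] by (auto simp: Phi_def x_eq)

abbreviation "Ps_at t \<equiv> Ps F Vs Vu (x t)"
abbreviation "Pu_at t \<equiv> Pu F Vs Vu (x t)"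
abbreviation "eps_at t \<equiv> eps_c F Vs Vu (x t)"
abbreviation "Ps0 \<equiv> Ps F Vs Vu x0"
abbreviation "Pu0 \<equiv> Pu F Vs Vu x0"
abbreviation "eps0 \<equiv> eps_c F Vs Vu x0"

lemma projections:
  assumes "a \<in> Vs (x t)" "b \<in> Vu (x t)"
  shows "Ps_at t (a + b + r *\<^sub>R F (x t)) = a" "Pu_at t (a + b + r *\<^sub>R F (x t)) = b"
    and "Pc F Vs Vu (x t) (a + b + r *\<^sub>R F (x t)) = r *\<^sub>R F (x t)"
    and "eps_at t (a + b + r *\<^sub>R F (x t)) = r"
  by (rule splitting_projections[where p = "x t" and F = F and Vs = Vs and Vu = Vu,
        OF splitting F_nonzero assms])+

lemma projections_mem: "Ps_at t u \<in> Vs (x t)" "Pu_at t u \<in> Vu (x t)"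
  and projections_sum: "Ps_at t u + Pu_at t u + eps_at t u *\<^sub>R F (x t) = u"
  and Pc_eps: "Pc F Vs Vu (x t) u = eps_at t u *\<^sub>R F (x t)"
proof -
  obtain a b r where u: "a \<in> Vs (x t)" "b \<in> Vu (x t)" "u = a + b + r *\<^sub>R F (x t)"
    by (rule decompose)
  note * = projections[OF u(1,2), of r, folded u(3)]
  show "Ps_at t u \<in> Vs (x t)" "Pu_at t u \<in> Vu (x t)"
    "Ps_at t u + Pu_at t u + eps_at t u *\<^sub>R F (x t) = u"
    "Pc F Vs Vu (x t) u = eps_at t u *\<^sub>R F (x t)"
    using u * by auto
qed

text \<open>\<open>Phi\<close> maps summands to summands and F to F, so it carries the decomposition
  of \<open>u\<close> to that of its image; uniqueness of decompositions does the rest.\<close>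

lemma projections_Phi:
  shows "Ps_at t (Phi t u) = Phi t (Ps0 u)" "Pu_at t (Phi t u) = Phi t (Pu0 u)"
    and "eps_at t (Phi t u) = eps0 u"
proof -
  obtain a b r where u: "a \<in> Vs x0" "b \<in> Vu x0" "u = a + b + r *\<^sub>R F x0"
    using decompose[of 0 u] by auto
  have "Phi t u = Phi t a + Phi t b + r *\<^sub>R F (x t)"
    by (simp add: u(3) blinfun.add_right blinfun.scaleR_right Phi_F)
  note * = projections[OF Phi_invariant(1)[OF u(1), of t] Phi_invariant(2)[OF u(2), of t], of r, folded this]
  note ** = projections[of a 0 b r, simplified, OF u(1,2), folded u(3)]
  show "Ps_at t (Phi t u) = Phi t (Ps0 u)" "Pu_at t (Phi t u) = Phi t (Pu0 u)"
    "eps_at t (Phi t u) = eps0 u"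
    using * ** by simp_all
qed

lemma projections_Psi:
  shows "Psi t (Ps_at t u) = Ps0 (Psi t u)" "Psi t (Pu_at t u) = Pu0 (Psi t u)"
    and "eps_at t u = eps0 (Psi t u)"
  using projections_Phi[of t "Psi t u"] by simp_all

lemma zero_in: "0 \<in> Vs (x t)" "0 \<in> Vu (x t)"
  using splitting[of t] by (auto simp: direct_sum3_def subspace_0)

lemma projections_on_summands:
  shows "a \<in> Vs x0 \<Longrightarrow> Ps0 a = a" "a \<in> Vs x0 \<Longrightarrow> Pu0 a = 0" "a \<in> Vs x0 \<Longrightarrow> eps0 a = 0"
    and "b \<in> Vu x0 \<Longrightarrow> Ps0 b = 0" "b \<in> Vu x0 \<Longrightarrow> Pu0 b = b" "b \<in> Vu x0 \<Longrightarrow> eps0 b = 0"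
    and "Ps0 (F x0) = 0" "Pu0 (F x0) = 0" "eps0 (F x0) = 1"
  using projections[of a 0 0 0, OF _ zero_in(2)] projections[of 0 0 b 0, OF zero_in(1)]
    projections[OF zero_in, of 0 1] by simp_all

lemma projections_sum_0: "Ps0 u + Pu0 u + eps0 u *\<^sub>R F x0 = u"
  using projections_sum[of 0 u] by simp

section \<open>Exponential estimates along the orbit\<close>

lemma contraction:
  obtains C a where "C > 0" "a > 0"
    "\<And>s t u. s \<le> t \<Longrightarrow> u \<in> Vs (x s) \<Longrightarrow>
       rnorm g (x t) (Phi t (Psi s u)) \<le> C * exp (- a * (t - s)) * rnorm g (x s) u"
    "\<And>s t u. t \<le> s \<Longrightarrow> u \<in> Vu (x s) \<Longrightarrow>
       rnorm g (x t) (Phi t (Psi s u)) \<le> C * exp (- a * (s - t)) * rnorm g (x s) u"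
proof -
  obtain C l where C: "C > 0" and l: "0 < l" "l < 1"
    and contr: "\<And>p t u. p \<in> K \<Longrightarrow> 0 \<le> t \<Longrightarrow> u \<in> Vu p \<Longrightarrow>
        rnorm g (f (- t) p) (pushforward A (f (- t)) p u) \<le> C * l powr t * rnorm g p u"
      "\<And>p t u. p \<in> K \<Longrightarrow> 0 \<le> t \<Longrightarrow> u \<in> Vs p \<Longrightarrow>
        rnorm g (f t p) (pushforward A (f t) p u) \<le> C * l powr t * rnorm g p u"
    using contraction_K by blast
  \<comment> \<open>The rate is a = - ln l, which is positive because l < 1.\<close>
  have powr: "l powr r = exp (- (- ln l) * r)" for r
    using l by (simp add: powr_def mult.commute)
  have s: "rnorm g (x t) (Phi t (Psi s u)) \<le> C * exp (- (- ln l) * (t - s)) * rnorm g (x s) u"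
    if "s \<le> t" "u \<in> Vs (x s)" for s t u
    using contr(2)[OF x_in_K, of "t - s" u s] that
    by (simp add: powr flow_x pushforward_orbit)
  have u: "rnorm g (x t) (Phi t (Psi s u)) \<le> C * exp (- (- ln l) * (s - t)) * rnorm g (x s) u"
    if "t \<le> s" "u \<in> Vu (x s)" for s t u
    using contr(1)[OF x_in_K, of "s - t" u s] that
    by (simp add: powr flow_x pushforward_orbit)
  have "- ln l > 0"
    using l by simp
  from that[OF C this s u] show thesis .
qed

lemma projections_bounded:
  obtains B where "B > 0"
    "\<And>t u. rnorm g (x t) (Ps_at t u) \<le> B * rnorm g (x t) u"
    "\<And>t u. rnorm g (x t) (Pu_at t u) \<le> B * rnorm g (x t) u"
    "\<And>t u. \<bar>eps_at t u\<bar> \<le> B * rnorm g (x t) u"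
proof -
  obtain B1 where B1: "B1 > 0" "\<And>p u. p \<in> K \<Longrightarrow> rnorm g p (Ps F Vs Vu p u) \<le> B1 * rnorm g p u"
    using continuous_endo_bounded[OF compact_K continuous_projections(1)] by metis
  obtain B2 where B2: "B2 > 0" "\<And>p u. p \<in> K \<Longrightarrow> rnorm g p (Pu F Vs Vu p u) \<le> B2 * rnorm g p u"
    using continuous_endo_bounded[OF compact_K continuous_projections(2)] by metis
  obtain B3 where B3: "B3 > 0" "\<And>p u. p \<in> K \<Longrightarrow> rnorm g p (Pc F Vs Vu p u) \<le> B3 * rnorm g p u"
    using continuous_endo_bounded[OF compact_K continuous_projections(3)] by metis
  obtain B4 where B4: "\<And>p. p \<in> K \<Longrightarrow> 1 \<le> B4 * rnorm g p (F p)"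
    using nonvanishing_field_bounded_below[OF compact_K smooth_F F_nonzero_K] by metis
  \<comment> \<open>The sign comes from the lower bound at \<open>x0\<close>: a nonpositive constant
    times a norm cannot reach 1.\<close>
  have "B4 > 0"
    using B4[OF x0_in_K] rnorm_nonneg[of x0 "F x0"] by (smt (verit) mult_nonpos_nonneg)
  \<comment> \<open>The third term bounds \<open>eps_at\<close>: \<open>B3\<close> bounds the flow
    component eps(u) F, and \<open>B4\<close> passes from its length to the number eps(u). A sum of
    positive constants dominates each of them.\<close>
  define B where "B = B1 + B2 + B4 * B3"
  have B: "B1 \<le> B" "B2 \<le> B" "B4 * B3 \<le> B" "B > 0"
    using B1(1) B2(1) mult_pos_pos[OF \<open>B4 > 0\<close> B3(1)] unfolding B_def by linarith+
  have "\<bar>eps_at t u\<bar> \<le> B4 * B3 * rnorm g (x t) u" for t u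
  proof -
    have "\<bar>eps_at t u\<bar> * 1 \<le> \<bar>eps_at t u\<bar> * (B4 * rnorm g (x t) (F (x t)))"
      by (intro mult_left_mono B4 x_in_K) simp
    also have "\<dots> = B4 * rnorm g (x t) (Pc F Vs Vu (x t) u)"
      by (simp add: Pc_eps rnorm_scaleR)
    also have "\<dots> \<le> B4 * (B3 * rnorm g (x t) u)"
      using \<open>B4 > 0\<close> by (intro mult_left_mono B3 x_in_K) simp
    finally show ?thesis
      by simp
  qed
  moreover have "r * rnorm g p u \<le> B * rnorm g p u" if "r \<le> B" for r p u
    using that by (intro mult_right_mono) auto
  ultimately show thesis
    using that[of B] B B1(2)[OF x_in_K] B2(2)[OF x_in_K] by (meson order_trans)
qed

lemma covfield_bound:
  assumes "\<mu> \<in> covfields A g x"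
  obtains B where "B \<ge> 0" "\<And>t u. \<bar>\<mu> t u\<bar> \<le> B * rnorm g (x t) u"
proof -
  obtain B where B: "\<And>t u. \<bar>\<mu> t u\<bar> \<le> B * rnorm g (x t) u"
    using assms unfolding covfields_def by blast
  have "\<bar>\<mu> t u\<bar> \<le> \<bar>B\<bar> * rnorm g (x t) u" for t u
    using B[of t u] by (rule order_trans) (simp add: mult_right_mono)
  then show thesis
    using that[of "\<bar>B\<bar>"] by simp
qed

text \<open>The covector is bounded at \<open>x t\<close>, while the tangent map reaching
  \<open>x t\<close> contracts Vs in the future and Vu in the past; the transported covector
  inherits the contraction.\<close>

lemma covfield_decay:
  assumes "\<mu> \<in> covfields A g x"
  obtains B a where "a > 0"
    "\<And>t. t \<ge> 0 \<Longrightarrow> norm ((\<mu> t o\<^sub>L Phi t) o\<^sub>L Ps0) \<le> B * exp (- a * t)"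
    "\<And>t. t \<le> 0 \<Longrightarrow> norm ((\<mu> t o\<^sub>L Phi t) o\<^sub>L Pu0) \<le> B * exp (a * t)"
proof -
  obtain D where D: "D \<ge> 0" "\<And>t u. \<bar>\<mu> t u\<bar> \<le> D * rnorm g (x t) u"
    using covfield_bound[OF assms] by metis
  obtain C a where C: "C > 0" "a > 0"
    and s: "\<And>s t u. s \<le> t \<Longrightarrow> u \<in> Vs (x s) \<Longrightarrow>
       rnorm g (x t) (Phi t (Psi s u)) \<le> C * exp (- a * (t - s)) * rnorm g (x s) u"
    and u: "\<And>s t u. t \<le> s \<Longrightarrow> u \<in> Vu (x s) \<Longrightarrow>
       rnorm g (x t) (Phi t (Psi s u)) \<le> C * exp (- a * (s - t)) * rnorm g (x s) u"
    by (rule contraction) (assumption | rule that)+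
  obtain P where P: "P > 0"
    "\<And>t u. rnorm g (x t) (Ps_at t u) \<le> P * rnorm g (x t) u"
    "\<And>t u. rnorm g (x t) (Pu_at t u) \<le> P * rnorm g (x t) u"
    by (rule projections_bounded) (assumption | rule that)+
  obtain M where M: "M > 0" "\<And>u. rnorm g x0 u \<le> M * norm u"
    by (rule rnorm_equivalent) (assumption | rule that)+
  \<comment> \<open>One estimate for both cases: \<open>L\<close> is the projection and
    \<open>E\<close> the exponential factor. The constant collects the bounds of \<mu>, contraction,
    projection, and the comparison of metric and Euclidean norm at \<open>x0\<close>.\<close>
  have bound: "norm ((\<mu> t o\<^sub>L Phi t) o\<^sub>L L) \<le> D * C * P * M * E"
    if "E > 0" "\<And>u. rnorm g x0 (L u) \<le> P * rnorm g x0 u"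
      "\<And>u. rnorm g (x t) (Phi t (L u)) \<le> C * E * rnorm g x0 (L u)" for t E and L :: "'e \<Rightarrow>\<^sub>L 'e"
  proof (rule norm_blinfun_bound)
    show "0 \<le> D * C * P * M * E"
      using D C P M that by simp
    fix u
    have "\<bar>\<mu> t (Phi t (L u))\<bar> \<le> D * rnorm g (x t) (Phi t (L u))"
      by (rule D)
    also have "\<dots> \<le> D * (C * E * rnorm g x0 (L u))"
      by (intro mult_left_mono that D)
    also have "\<dots> \<le> D * (C * E * (P * rnorm g x0 u))"
      using D C that by (intro mult_left_mono that) auto
    also have "\<dots> \<le> D * (C * E * (P * (M * norm u)))"
      using D C P that by (intro mult_left_mono M) auto
    finally show "norm (((\<mu> t o\<^sub>L Phi t) o\<^sub>L L) u) \<le> D * C * P * M * E * norm u"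
      by (simp add: mult_ac)
  qed
  have "norm ((\<mu> t o\<^sub>L Phi t) o\<^sub>L Ps0) \<le> D * C * P * M * exp (- a * t)" if "t \<ge> 0" for t
    using s[of 0 t] P(2)[of 0] projections_mem(1)[of 0] that by (intro bound) auto
  moreover have "norm ((\<mu> t o\<^sub>L Phi t) o\<^sub>L Pu0) \<le> D * C * P * M * exp (a * t)" if "t \<le> 0" for t
    using u[of t 0] P(3)[of 0] projections_mem(2)[of 0] that by (intro bound) auto
  ultimately show thesis
    using that C(2) by blast
qed

text \<open>The description defining \<open>shadow_op\<close> is met by exactly one class once some
  pair solves the equation: the class of all solutions. Without a solution it would denote nothing
  specific.\<close>

lemma shadow_opE:
  assumes a: "a \<in> shadow_op A g F f x X"
    and ex: "\<exists>b\<in>shadow_pairs A g x. perturbation A F f x b = X"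
  shows "a \<in> shadow_pairs A g x" "perturbation A F f x a = X"
proof -
  let ?q = "{b \<in> shadow_pairs A g x. perturbation A F f x b = X}"
  have cls: "shadow_rel A g F f x `` {b} = ?q"
    if "b \<in> shadow_pairs A g x" "perturbation A F f x b = X" for b
    using that by (auto simp: shadow_rel_def)
  have "shadow_op A g F f x X = ?q"
    unfolding shadow_op_def
  proof (rule the_equality)
    show "?q \<in> shadow_space A g F f x \<and> (\<forall>a\<in>?q. perturbation A F f x a = X)"
      using ex cls by (auto simp: shadow_space_def quotient_def)
  next
    fix q assume q: "q \<in> shadow_space A g F f x \<and> (\<forall>a\<in>q. perturbation A F f x a = X)"
    then obtain b where b: "b \<in> shadow_pairs A g x" "q = shadow_rel A g F f x `` {b}"
      by (auto simp: shadow_space_def quotient_def)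
    \<comment> \<open>A class contains its representative, so the universally quantified condition
      on \<open>q\<close> is not vacuous and forces \<open>b\<close> to solve the equation.\<close>
    then have "b \<in> q"
      by (auto simp: shadow_rel_def)
    with q b cls show "q = ?q"
      by blast
  qed
  with a show "a \<in> shadow_pairs A g x" "perturbation A F f x a = X"
    by simp_all
qed

lemma bounded_linear_metric_Phi: "bounded_linear (\<lambda>u. g (x t) w (Phi t u))"
proof -
  have "bounded_linear (g (x t) w)"
    using bilinear_g by (simp add: bilinear_def linear_conv_bounded_linear)
  then show ?thesis
    by (rule bounded_linear_compose[OF _ blinfun.bounded_linear_right])
qed

text \<open>Variation of constants: the stable part is integrated from the past, the unstable part from
  the future, so that both integrals converge.\<close>
lemma shadowing_exists:
  assumes X: "X \<in> vfields A g x"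
  shows "\<exists>b\<in>shadow_pairs A g x. perturbation A F f x b = X"
proof -
  define Y where "Y t = Psi t (X t)" for t
  have Y_cont: "continuous_on UNIV Y"
    using X unfolding Y_def vfields_def by (intro transported_vfield_continuous) auto
  have X_Y: "X t = Phi t (Y t)" for t
    by (simp add: Y_def)
  obtain D where D: "\<And>t. rnorm g (x t) (X t) \<le> D"
    using X unfolding vfields_def by blast
  have "D \<ge> 0"
    using D[of 0] rnorm_nonneg[of "x 0" "X 0"] by linarith
  obtain C a where C: "C > 0" "a > 0"
    and s: "\<And>s t u. s \<le> t \<Longrightarrow> u \<in> Vs (x s) \<Longrightarrow>
       rnorm g (x t) (Phi t (Psi s u)) \<le> C * exp (- a * (t - s)) * rnorm g (x s) u"
    and u: "\<And>s t u. t \<le> s \<Longrightarrow> u \<in> Vu (x s) \<Longrightarrow>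
       rnorm g (x t) (Phi t (Psi s u)) \<le> C * exp (- a * (s - t)) * rnorm g (x s) u"
    by (rule contraction) (assumption | rule that)+
  obtain P where P: "P > 0"
    "\<And>t u. rnorm g (x t) (Ps_at t u) \<le> P * rnorm g (x t) u"
    "\<And>t u. rnorm g (x t) (Pu_at t u) \<le> P * rnorm g (x t) u"
    "\<And>t u. \<bar>eps_at t u\<bar> \<le> P * rnorm g (x t) u"
    by (rule projections_bounded) (assumption | rule that)+
  obtain m where m: "m > 0" "\<And>u. m * norm u \<le> rnorm g x0 u"
    by (rule rnorm_equivalent) (assumption | rule that)+
  define Ys where "Ys t = Ps0 (Y t)" for t
  define Yu where "Yu t = Pu0 (Y t)" for t
  let ?B = "C * (P * D)"
  have Ys: "rnorm g (x t) (Phi t (Ys s)) \<le> ?B * exp (- a * (t - s))" if "s \<le> t" for s t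
  proof -
    have "rnorm g (x t) (Phi t (Ys s)) \<le> C * exp (- a * (t - s)) * rnorm g (x s) (Ps_at s (X s))"
      using s[OF that projections_mem(1)] by (simp add: Ys_def Y_def projections_Psi)
    also have "\<dots> \<le> C * exp (- a * (t - s)) * (P * D)"
      using C P D by (intro mult_left_mono order_trans[OF P(2)]) auto
    finally show ?thesis
      by (simp add: mult_ac)
  qed
  have Yu: "rnorm g (x t) (Phi t (Yu s)) \<le> ?B * exp (- a * (s - t))" if "t \<le> s" for s t
  proof -
    have "rnorm g (x t) (Phi t (Yu s)) \<le> C * exp (- a * (s - t)) * rnorm g (x s) (Pu_at s (X s))"
      using u[OF that projections_mem(2)] by (simp add: Yu_def Y_def projections_Psi)
    also have "\<dots> \<le> C * exp (- a * (s - t)) * (P * D)"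
      using C P D by (intro mult_left_mono order_trans[OF P(3)]) auto
    finally show ?thesis
      by (simp add: mult_ac)
  qed
  have cont: "continuous_on UNIV Ys" "continuous_on UNIV Yu"
    unfolding Ys_def Yu_def by (intro blinfun.continuous_on continuous_on_const Y_cont)+
  \<comment> \<open>The estimate is read at t = 0, where \<open>Phi 0\<close> is the identity, and
    divided by \<open>m\<close> to pass to the Euclidean norm.\<close>
  have norm_Ys: "norm (Ys s) \<le> ?B / m * exp (a * s)" if "s \<le> 0" for s
    using Ys[OF that] m(2)[of "Ys s"] m(1) by (simp add: field_simps)
  have norm_Yu: "norm (Yu s) \<le> ?B / m * exp (- a * s)" if "s \<ge> 0" for s
    using Yu[OF that] m(2)[of "Yu s"] m(1) by (simp add: field_simps)
  note past = decaying_past[OF cont(1) C(2) norm_Ys]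
  note tail = decaying_tail[OF cont(2) C(2) norm_Yu]
  \<comment> \<open>With this sign both limits of integration contribute positively, so the
    derivative is Ys + Yu.\<close>
  define w where "w t = integral {..t} Ys - integral {t..} Yu" for t
  have "(w has_vector_derivative Ys t - - Yu t) (at t)" for t
    unfolding w_def by (intro has_vector_derivative_diff past(2) tail(2))
  moreover have "Ys t - - Yu t = Y t - eps0 (Y t) *\<^sub>R F x0" for t
    using projections_sum_0[of "Y t"] by (simp add: Ys_def Yu_def algebra_simps)
  ultimately have w: "(w has_vector_derivative Y t - eps0 (Y t) *\<^sub>R F x0) (at t)" for t
    by metis
  have past_bound: "rnorm g (x t) (Phi t (integral {..t} Ys)) \<le> ?B / a" for t
  proof (rule rnorm_le_dual)
    fix z
    \<comment> \<open>A scalar functional commutes with the integral; its integrand is estimated in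
      the metric at \<open>x t\<close>, which gives a bound independent of t.\<close>
    let ?\<phi> = "\<lambda>u. g (x t) z (Phi t u)"
    note \<phi> = bounded_linear_metric_Phi[of t z]
    have bnd: "norm (?\<phi> (Ys s)) \<le> rnorm g (x t) z * ?B * exp (- a * (t - s))" if "s \<le> t" for s
    proof -
      have "norm (?\<phi> (Ys s)) \<le> rnorm g (x t) z * rnorm g (x t) (Phi t (Ys s))"
        using Cauchy_Schwarz_g[of "x t" z "Phi t (Ys s)"] Cauchy_Schwarz_g[of "x t" z "- Phi t (Ys s)"]
        by (simp add: rnorm_minus bilinear_rneg[OF bilinear_g] abs_le_iff)
      also have "\<dots> \<le> rnorm g (x t) z * (?B * exp (- a * (t - s)))"
        by (intro mult_left_mono Ys that) simp
      finally show ?thesis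
        by (simp add: mult_ac)
    qed
    have "continuous_on {..t} (\<lambda>s. ?\<phi> (Ys s))"
      by (rule continuous_on_subset[OF bounded_linear.continuous_on[OF \<phi> cont(1)]]) simp
    from integrable_exp_past(2)[OF this C(2) bnd]
    have "norm (integral {..t} (\<lambda>s. ?\<phi> (Ys s))) \<le> rnorm g (x t) z * ?B / a" .
    moreover have "integral {..t} (\<lambda>s. ?\<phi> (Ys s)) = ?\<phi> (integral {..t} Ys)"
      using integral_linear[OF past(1) \<phi>] by (simp add: o_def)
    ultimately show "?\<phi> (integral {..t} Ys) \<le> ?B / a * rnorm g (x t) z"
      by (simp add: mult_ac)
  qed
  have tail_bound: "rnorm g (x t) (Phi t (integral {t..} Yu)) \<le> ?B / a" for t
  proof (rule rnorm_le_dual)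
    fix z
    let ?\<phi> = "\<lambda>u. g (x t) z (Phi t u)"
    note \<phi> = bounded_linear_metric_Phi[of t z]
    have bnd: "norm (?\<phi> (Yu s)) \<le> rnorm g (x t) z * ?B * exp (- a * (s - t))" if "s \<ge> t" for s
    proof -
      have "norm (?\<phi> (Yu s)) \<le> rnorm g (x t) z * rnorm g (x t) (Phi t (Yu s))"
        using Cauchy_Schwarz_g[of "x t" z "Phi t (Yu s)"] Cauchy_Schwarz_g[of "x t" z "- Phi t (Yu s)"]
        by (simp add: rnorm_minus bilinear_rneg[OF bilinear_g] abs_le_iff)
      also have "\<dots> \<le> rnorm g (x t) z * (?B * exp (- a * (s - t)))"
        by (intro mult_left_mono Yu that) simp
      finally show ?thesis
        by (simp add: mult_ac)
    qed
    have "continuous_on {t..} (\<lambda>s. ?\<phi> (Yu s))"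
      by (rule continuous_on_subset[OF bounded_linear.continuous_on[OF \<phi> cont(2)]]) simp
    from integrable_exp_tail(2)[OF this C(2) bnd]
    have "norm (integral {t..} (\<lambda>s. ?\<phi> (Yu s))) \<le> rnorm g (x t) z * ?B / a" .
    moreover have "integral {t..} (\<lambda>s. ?\<phi> (Yu s)) = ?\<phi> (integral {t..} Yu)"
      using integral_linear[OF tail(1) \<phi>] by (simp add: o_def)
    ultimately show "?\<phi> (integral {t..} Yu) \<le> ?B / a * rnorm g (x t) z"
      by (simp add: mult_ac)
  qed
  define v where "v t = Phi t (w t)" for t
  \<comment> \<open>The flow component of X, which decays in neither time direction, is not
    integrated into \<open>v\<close> but taken up by the term \<eta> F.\<close>
  define \<eta> where "\<eta> t = eps0 (Y t)" for t
  have \<eta>_cont: "continuous_on UNIV \<eta>"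
    unfolding \<eta>_def by (intro blinfun.continuous_on continuous_on_const Y_cont)
  have v_C1: "(\<lambda>t. to_chart A c (x t) (v t)) C1_differentiable_on {t. x t \<in> cdom c}" if "c \<in> A" for c
    unfolding v_def
  proof (rule C1_vfield_of_transported[OF that w])
    show "continuous_on UNIV (\<lambda>t. Y t - eps0 (Y t) *\<^sub>R F x0)"
      by (intro continuous_intros blinfun.continuous_on Y_cont)
  qed
  have v_bound: "rnorm g (x t) (v t) \<le> ?B / a + ?B / a" for t
    using past_bound[of t] tail_bound[of t]
      rnorm_diff_le[of "x t" "Phi t (integral {..t} Ys)" "Phi t (integral {t..} Yu)"]
    unfolding v_def w_def blinfun.diff_right by linarith
  have "v \<in> C1_vfields A g x"
    using v_C1 v_bound C1_differentiable_imp_continuous_on[OF v_C1]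
    unfolding C1_vfields_def vfields_def by blast
  moreover have "\<eta> \<in> funs"
  proof -
    have "\<bar>\<eta> t\<bar> \<le> P * D" for t
      using order_trans[OF P(4)[of t "X t"] mult_left_mono[OF D[of t]]] P(1)
      by (simp add: \<eta>_def Y_def projections_Psi)
    then show ?thesis
      using \<eta>_cont by (auto simp: funs_def intro!: boundedI)
  qed
  ultimately have "(v, \<eta>) \<in> shadow_pairs A g x"
    by (simp add: shadow_pairs_def)
  moreover have "perturbation A F f x (v, \<eta>) t = X t" for t
  proof -
    have "lie_vec A f x v t = Phi t (Y t - eps0 (Y t) *\<^sub>R F x0)"
      using w by (intro lie_vec_transported) (simp add: v_def)
    then show ?thesis
      by (simp add: perturbation_def \<eta>_def blinfun.diff_right blinfun.scaleR_right Phi_F X_Y)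
  qed
  ultimately show ?thesis
    by (intro bexI[of _ "(v, \<eta>)"] ext) auto
qed

end

section \<open>The adjoint equation\<close>

locale adjoint_orbit = hyperbolic_orbit A F f g x x0 K Vs Vu
  for A :: "('m::{t2_space,second_countable_topology}, 'e::euclidean_space) chart set"
    and F :: "'m \<Rightarrow> 'e" and f :: "real \<Rightarrow> 'm \<Rightarrow> 'm"
    and g :: "'m \<Rightarrow> 'e \<Rightarrow> 'e \<Rightarrow> real" and x :: "real \<Rightarrow> 'm" and x0 :: 'm
    and K :: "'m set" and Vs Vu :: "'m \<Rightarrow> 'e set" +
  fixes \<omega> :: "real \<Rightarrow> 'e \<Rightarrow>\<^sub>L real" and \<psi> :: "real \<Rightarrow> real"
  assumes pair: "(\<omega>, \<psi>) \<in> adjoint_pairs A g F x"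
begin

definition om :: "real \<Rightarrow> 'e \<Rightarrow>\<^sub>L real" where "om t = \<omega> t o\<^sub>L Phi t"

lemma \<omega>_covfield: "\<omega> \<in> covfields A g x"
  using pair by (simp add: adjoint_pairs_def)

lemma om_cont: "continuous_on UNIV om"
  using \<omega>_covfield unfolding om_def[abs_def] covfields_def
  by (intro transported_covfield_continuous) auto

lemma \<psi>_deriv: "(\<psi> has_vector_derivative om t (F x0)) (at t)"
proof -
  have "\<psi> differentiable (at t)" "vector_derivative \<psi> (at t) = \<omega> t (F (x t))"
    using pair by (auto simp: adjoint_pairs_def C1_funs_def intro: C1_differentiable_at)
  then show ?thesis
    by (simp add: vector_derivative_works om_def Phi_F)
qed

text \<open>The right-hand side of the expansion formula carried to the dual of the tangent space at
  \<open>x0\<close>; the pullbacks compose with \<open>Phi \<tau>\<close> so that the integrands no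
  longer depend on \<tau>.\<close>

definition N :: "real \<Rightarrow> 'e \<Rightarrow>\<^sub>L real" where
  "N \<tau> = integral {\<tau>..} (\<lambda>t. om t o\<^sub>L Ps0) - integral {..\<tau>} (\<lambda>t. om t o\<^sub>L Pu0) - \<psi> \<tau> *\<^sub>R eps0"

lemma om_projections_cont: "continuous_on UNIV (\<lambda>t. om t o\<^sub>L Ps0)" "continuous_on UNIV (\<lambda>t. om t o\<^sub>L Pu0)"
  by (intro bounded_bilinear.continuous_on[OF bounded_bilinear_blinfun_compose] om_cont continuous_on_const)+

lemma om_integrals:
  shows om_tail_integrable: "(\<lambda>t. om t o\<^sub>L Ps0) integrable_on {\<tau>..}"
    and om_tail_deriv: "((\<lambda>s. integral {s..} (\<lambda>t. om t o\<^sub>L Ps0)) has_vector_derivative - (om \<tau> o\<^sub>L Ps0)) (at \<tau>)"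
    and om_tail_tendsto: "((\<lambda>s. integral {s..} (\<lambda>t. om t o\<^sub>L Ps0)) \<longlongrightarrow> 0) at_top"
    and om_past_integrable: "(\<lambda>t. om t o\<^sub>L Pu0) integrable_on {..\<tau>}"
    and om_past_deriv: "((\<lambda>s. integral {..s} (\<lambda>t. om t o\<^sub>L Pu0)) has_vector_derivative om \<tau> o\<^sub>L Pu0) (at \<tau>)"
    and om_past_tendsto: "((\<lambda>s. integral {..s} (\<lambda>t. om t o\<^sub>L Pu0)) \<longlongrightarrow> 0) at_bot"
proof -
  obtain B a where "a > 0"
    and s: "\<And>t. t \<ge> 0 \<Longrightarrow> norm (om t o\<^sub>L Ps0) \<le> B * exp (- a * t)"
    and u: "\<And>t. t \<le> 0 \<Longrightarrow> norm (om t o\<^sub>L Pu0) \<le> B * exp (a * t)"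
    by (rule covfield_decay[OF \<omega>_covfield, folded om_def]) (assumption | rule that)+
  note * = decaying_tail[OF om_projections_cont(1) \<open>a > 0\<close> s]
    decaying_past[OF om_projections_cont(2) \<open>a > 0\<close> u]
  show "(\<lambda>t. om t o\<^sub>L Ps0) integrable_on {\<tau>..}"
    "((\<lambda>s. integral {s..} (\<lambda>t. om t o\<^sub>L Ps0)) has_vector_derivative - (om \<tau> o\<^sub>L Ps0)) (at \<tau>)"
    "((\<lambda>s. integral {s..} (\<lambda>t. om t o\<^sub>L Ps0)) \<longlongrightarrow> 0) at_top"
    "(\<lambda>t. om t o\<^sub>L Pu0) integrable_on {..\<tau>}"
    "((\<lambda>s. integral {..s} (\<lambda>t. om t o\<^sub>L Pu0)) has_vector_derivative om \<tau> o\<^sub>L Pu0) (at \<tau>)"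
    "((\<lambda>s. integral {..s} (\<lambda>t. om t o\<^sub>L Pu0)) \<longlongrightarrow> 0) at_bot"
    by (rule * | assumption)+
qed

text \<open>The three derivatives reassemble \<open>om\<close>, since the projections sum to the
  identity; the flow part is where F(\<psi>) = \<omega>(F) enters.\<close>

lemma N_deriv: "(N has_vector_derivative - om \<tau>) (at \<tau>)"
proof -
  have "((\<lambda>t. \<psi> t *\<^sub>R eps0) has_vector_derivative om \<tau> (F x0) *\<^sub>R eps0) (at \<tau>)"
    by (rule bounded_linear.has_vector_derivative[OF bounded_linear_scaleR_left \<psi>_deriv])
  then have "(N has_vector_derivative
      - (om \<tau> o\<^sub>L Ps0) - (om \<tau> o\<^sub>L Pu0) - om \<tau> (F x0) *\<^sub>R eps0) (at \<tau>)"
    unfolding N_def[abs_def]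
    by (intro has_vector_derivative_diff om_tail_deriv om_past_deriv)
  moreover have "- (om \<tau> o\<^sub>L Ps0) - (om \<tau> o\<^sub>L Pu0) - om \<tau> (F x0) *\<^sub>R eps0 = - om \<tau>"
  proof (rule blinfun_eqI)
    fix u
    have "om \<tau> u = om \<tau> (Ps0 u + Pu0 u + eps0 u *\<^sub>R F x0)"
      by (simp add: projections_sum_0)
    then show "(- (om \<tau> o\<^sub>L Ps0) - (om \<tau> o\<^sub>L Pu0) - om \<tau> (F x0) *\<^sub>R eps0) u = (- om \<tau>) u"
      by (simp add: blinfun.bilinear_simps)
  qed
  ultimately show ?thesis
    by simp
qed

lemma N_apply:
  shows "u \<in> Vs x0 \<Longrightarrow> N t u = integral {t..} (\<lambda>t. om t o\<^sub>L Ps0) u"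
    and "u \<in> Vu x0 \<Longrightarrow> N t u = - integral {..t} (\<lambda>t. om t o\<^sub>L Pu0) u"
    and "N t (F x0) = - \<psi> t"
  by (simp_all add: N_def blinfun.bilinear_simps integral_blinfun_apply om_tail_integrable
      om_past_integrable projections_on_summands)

text \<open>The integrals commute with composition by the fixed map \<open>Psi \<tau>\<close>, and
  exponential decay discharges the integrability clauses of the formula.\<close>

lemma expansion_iff: "expansion_formula A F f Vs Vu x \<omega> \<psi> \<nu> \<longleftrightarrow> (\<forall>\<tau>. \<nu> \<tau> o\<^sub>L Phi \<tau> = N \<tau>)"
proof -
  have "(let hs = (\<lambda>t. pullback A (f (t - \<tau>)) (x \<tau>) (\<omega> t o\<^sub>L Ps F Vs Vu (x t)));
             hu = (\<lambda>t. pullback A (f (t - \<tau>)) (x \<tau>) (\<omega> t o\<^sub>L Pu F Vs Vu (x t)))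
         in hs integrable_on {\<tau>..} \<and> hu integrable_on {..\<tau>} \<and>
            \<nu> \<tau> = integral {\<tau>..} hs - integral {..\<tau>} hu - \<psi> \<tau> *\<^sub>R eps_c F Vs Vu (x \<tau>)) \<longleftrightarrow>
        \<nu> \<tau> o\<^sub>L Phi \<tau> = N \<tau>" for \<tau>
  proof -
    let ?R = "\<lambda>L :: 'e \<Rightarrow>\<^sub>L real. L o\<^sub>L Psi \<tau>"
    have R: "bounded_linear ?R"
      by (rule bounded_bilinear.bounded_linear_left[OF bounded_bilinear_blinfun_compose])
    have hs: "(\<lambda>t. pullback A (f (t - \<tau>)) (x \<tau>) (\<omega> t o\<^sub>L Ps F Vs Vu (x t))) = ?R \<circ> (\<lambda>t. om t o\<^sub>L Ps0)"
      and hu: "(\<lambda>t. pullback A (f (t - \<tau>)) (x \<tau>) (\<omega> t o\<^sub>L Pu F Vs Vu (x t))) = ?R \<circ> (\<lambda>t. om t o\<^sub>L Pu0)"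
      by (auto simp: fun_eq_iff pullback_def pushforward_orbit om_def projections_Phi intro!: blinfun_eqI)
    have eps: "eps_c F Vs Vu (x \<tau>) = ?R eps0"
      by (rule blinfun_eqI) (simp add: projections_Psi)
    have "integral {\<tau>..} (?R \<circ> (\<lambda>t. om t o\<^sub>L Ps0)) - integral {..\<tau>} (?R \<circ> (\<lambda>t. om t o\<^sub>L Pu0)) - \<psi> \<tau> *\<^sub>R ?R eps0
        = ?R (N \<tau>)"
      by (simp add: integral_linear[OF om_tail_integrable R] integral_linear[OF om_past_integrable R]
          N_def linear_diff[OF bounded_linear.linear[OF R]] linear_cmul[OF bounded_linear.linear[OF R]])
    moreover have "\<nu> \<tau> = ?R (N \<tau>) \<longleftrightarrow> \<nu> \<tau> o\<^sub>L Phi \<tau> = N \<tau>"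
      by (rule eq_compose_Psi_iff)
    ultimately show ?thesis
      unfolding Let_def hs hu eps
      using integrable_linear[OF om_tail_integrable R] integrable_linear[OF om_past_integrable R] by simp
  qed
  then show ?thesis
    unfolding expansion_formula_def by simp
qed

text \<open>The covariant form is the Lie form by definition of \<open>nabla_nu\<close>.
  Differentiability gives the equation its content, since \<open>vector_derivative\<close> is
  arbitrary where no derivative exists.\<close>

lemma adjoint_solution_iff:
  "adjoint_solution A g F f x \<omega> \<psi> S \<mu> \<longleftrightarrow> \<mu> \<in> covfields A g x \<and>
     (\<forall>\<tau>. ((\<lambda>t. \<mu> t o\<^sub>L Phi t) has_vector_derivative - om \<tau>) (at \<tau>)) \<and>
     (\<forall>\<tau>\<in>S. \<mu> \<tau> (F (x \<tau>)) = - \<psi> \<tau>)"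
proof -
  have "differentiable_covfield A x \<mu> \<and> (\<forall>\<tau>. lie_cov A f x \<mu> \<tau> = - \<omega> \<tau>) \<longleftrightarrow>
      (\<forall>\<tau>. ((\<lambda>t. \<mu> t o\<^sub>L Phi t) has_vector_derivative - om \<tau>) (at \<tau>))" (is "?L \<longleftrightarrow> ?R")
  proof
    assume L: ?L
    show ?R
    proof
      fix \<tau>
      have d: "((\<lambda>t. \<mu> t o\<^sub>L Phi t) has_vector_derivative vector_derivative (\<lambda>t. \<mu> t o\<^sub>L Phi t) (at \<tau>)) (at \<tau>)"
        using L by (simp add: differentiable_covfield_iff vector_derivative_works)
      have "- \<omega> \<tau> = vector_derivative (\<lambda>t. \<mu> t o\<^sub>L Phi t) (at \<tau>) o\<^sub>L Psi \<tau>"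
        using L lie_cov_transported[OF d] by simp
      then have "vector_derivative (\<lambda>t. \<mu> t o\<^sub>L Phi t) (at \<tau>) = - \<omega> \<tau> o\<^sub>L Phi \<tau>"
        by (simp only: eq_compose_Psi_iff)
      also have "\<dots> = - om \<tau>"
        by (rule blinfun_eqI) (simp add: om_def blinfun.minus_left)
      finally show "((\<lambda>t. \<mu> t o\<^sub>L Phi t) has_vector_derivative - om \<tau>) (at \<tau>)"
        using d by simp
    qed
  next
    assume R: ?R
    have "- om \<tau> o\<^sub>L Psi \<tau> = - \<omega> \<tau>" for \<tau>
      by (rule blinfun_eqI) (simp add: om_def blinfun.minus_left)
    then have "lie_cov A f x \<mu> \<tau> = - \<omega> \<tau>" for \<tau>
      using lie_cov_transported[OF R[rule_format]] by simp
    with R show ?L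
      by (auto simp: differentiable_covfield_iff intro: differentiableI_vector)
  qed
  then show ?thesis
    by (auto simp: adjoint_solution_def nabla_nu_def)
qed

text \<open>The difference of two solutions is constant after transport to the initial point, and the
  constant vanishes on each summand of the splitting.\<close>
lemma solution_unique:
  assumes \<mu>: "\<mu> \<in> covfields A g x"
    and deriv: "\<And>\<tau>. ((\<lambda>t. \<mu> t o\<^sub>L Phi t) has_vector_derivative - om \<tau>) (at \<tau>)"
    and norm: "\<mu> \<tau>0 (F (x \<tau>0)) = - \<psi> \<tau>0"
  shows "\<mu> \<tau> o\<^sub>L Phi \<tau> = N \<tau>"
proof -
  have "((\<lambda>t. (\<mu> t o\<^sub>L Phi t) - N t) has_vector_derivative - om t - - om t) (at t)" for t
    by (intro has_vector_derivative_diff deriv N_deriv)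
  then have "\<exists>c. \<forall>t\<in>UNIV. (\<mu> t o\<^sub>L Phi t) - N t = c"
    by (intro has_derivative_zero_constant) (simp_all add: has_vector_derivative_def)
  then obtain c where c: "\<And>t. (\<mu> t o\<^sub>L Phi t) - N t = c"
    by auto
  have c_apply: "c u = \<mu> t (Phi t u) - N t u" for t u
    by (simp add: blinfun.diff_left flip: c[of t])
  obtain B a where a: "a > 0"
    and s: "\<And>t. t \<ge> 0 \<Longrightarrow> norm ((\<mu> t o\<^sub>L Phi t) o\<^sub>L Ps0) \<le> B * exp (- a * t)"
    and u: "\<And>t. t \<le> 0 \<Longrightarrow> norm ((\<mu> t o\<^sub>L Phi t) o\<^sub>L Pu0) \<le> B * exp (a * t)"
    by (rule covfield_decay[OF \<mu>]) (assumption | rule that)+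
  \<comment> \<open>Both \<mu> and \<open>N\<close> tend to 0 on \<open>w\<close> as t grows, and
    their difference does not depend on t.\<close>
  have c_s: "c w = 0" if w: "w \<in> Vs x0" for w
  proof -
    have lim: "((\<lambda>t. B * exp (- a * t) * norm w) \<longlongrightarrow> 0) at_top"
      by (intro tendsto_mult_left_zero tendsto_mult_right_zero filterlim_compose[OF exp_at_bot]
          filterlim_tendsto_neg_mult_at_bot[OF tendsto_const _ filterlim_ident]) (use a in simp)
    have "norm (\<mu> t (Phi t w)) \<le> B * exp (- a * t) * norm w" if "t \<ge> 0" for t
    proof -
      have "norm (\<mu> t (Phi t w)) \<le> norm ((\<mu> t o\<^sub>L Phi t) o\<^sub>L Ps0) * norm w"
        using norm_blinfun[of "(\<mu> t o\<^sub>L Phi t) o\<^sub>L Ps0" w] by (simp add: projections_on_summands w)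
      also have "\<dots> \<le> B * exp (- a * t) * norm w"
        by (intro mult_right_mono s that) simp
      finally show ?thesis .
    qed
    then have "((\<lambda>t. \<mu> t (Phi t w)) \<longlongrightarrow> 0) at_top"
      by (intro Lim_null_comparison[OF _ lim] eventually_at_top_linorderI[of 0])
    moreover have "((\<lambda>t. N t w) \<longlongrightarrow> 0) at_top"
      using blinfun.tendsto[OF om_tail_tendsto tendsto_const[of w]]
      by (simp add: N_apply(1)[OF w])
    ultimately have "((\<lambda>t. \<mu> t (Phi t w) - N t w) \<longlongrightarrow> 0 - 0) at_top"
      by (rule tendsto_diff)
    then show ?thesis
      by (simp add: tendsto_const_iff flip: c_apply)
  qed
  have c_u: "c w = 0" if w: "w \<in> Vu x0" for w
  proof -
    have lim: "((\<lambda>t. B * exp (a * t) * norm w) \<longlongrightarrow> 0) at_bot"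
      by (intro tendsto_mult_left_zero tendsto_mult_right_zero filterlim_compose[OF exp_at_bot]
          filterlim_tendsto_pos_mult_at_bot[OF tendsto_const _ filterlim_ident]) (use a in simp)
    have "norm (\<mu> t (Phi t w)) \<le> B * exp (a * t) * norm w" if "t \<le> 0" for t
    proof -
      have "norm (\<mu> t (Phi t w)) \<le> norm ((\<mu> t o\<^sub>L Phi t) o\<^sub>L Pu0) * norm w"
        using norm_blinfun[of "(\<mu> t o\<^sub>L Phi t) o\<^sub>L Pu0" w] by (simp add: projections_on_summands w)
      also have "\<dots> \<le> B * exp (a * t) * norm w"
        by (intro mult_right_mono u that) simp
      finally show ?thesis .
    qed
    then have "\<forall>\<^sub>F t in at_bot. norm (\<mu> t (Phi t w)) \<le> B * exp (a * t) * norm w"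
      unfolding eventually_at_bot_linorder by blast
    then have "((\<lambda>t. \<mu> t (Phi t w)) \<longlongrightarrow> 0) at_bot"
      by (rule Lim_null_comparison[OF _ lim])
    moreover have "((\<lambda>t. N t w) \<longlongrightarrow> 0) at_bot"
      using tendsto_minus[OF blinfun.tendsto[OF om_past_tendsto tendsto_const[of w]]]
      by (simp add: N_apply(2)[OF w])
    ultimately have "((\<lambda>t. \<mu> t (Phi t w) - N t w) \<longlongrightarrow> 0 - 0) at_bot"
      by (rule tendsto_diff)
    then show ?thesis
      by (simp add: tendsto_const_iff flip: c_apply)
  qed
  \<comment> \<open>As the difference is constant in time, agreement on F at the single time
    \<open>\<tau>0\<close> suffices.\<close>
  have c_F: "c (F x0) = 0"
    using norm by (simp add: c_apply[of _ \<tau>0] Phi_F N_apply)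
  have "c = 0"
  proof (rule blinfun_eqI)
    fix u
    have "c u = c (Ps0 u + Pu0 u + eps0 u *\<^sub>R F x0)"
      by (simp add: projections_sum_0)
    then show "c u = blinfun_apply 0 u"
      using c_s[of "Ps0 u"] c_u[of "Pu0 u"] c_F projections_mem[of 0 u]
      by (simp add: blinfun.add_right blinfun.scaleR_right)
  qed
  with c[of \<tau>] show ?thesis
    by simp
qed

text \<open>Uniqueness needs the normalization at one time only, while the expansion formula
  satisfies it at all times; hence every nonempty set of times gives the same condition.\<close>

lemma unique_solution_iff_expansion:
  assumes "\<nu> \<in> covfields A g x" "S \<noteq> {}"
  shows "unique_adjoint_solution A g F f x \<omega> \<psi> S \<nu> \<longleftrightarrow> expansion_formula A F f Vs Vu x \<omega> \<psi> \<nu>"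
proof -
  have N: "\<forall>\<tau>. \<mu> \<tau> o\<^sub>L Phi \<tau> = N \<tau>" if "adjoint_solution A g F f x \<omega> \<psi> S \<mu>" for \<mu>
    using that assms(2) solution_unique unfolding adjoint_solution_iff by blast
  show ?thesis
    unfolding expansion_iff
  proof
    assume "unique_adjoint_solution A g F f x \<omega> \<psi> S \<nu>"
    then show "\<forall>\<tau>. \<nu> \<tau> o\<^sub>L Phi \<tau> = N \<tau>"
      by (intro N) (simp add: unique_adjoint_solution_def)
  next
    assume \<nu>: "\<forall>\<tau>. \<nu> \<tau> o\<^sub>L Phi \<tau> = N \<tau>"
    have "\<nu> \<tau> (F (x \<tau>)) = - \<psi> \<tau>" for \<tau>
      using \<nu>[rule_format, of \<tau>, symmetric] N_apply(3)[of \<tau>] by (simp add: Phi_F)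
    \<comment> \<open>Boundedness and continuity of \<nu> are taken from the assumption that it is a
      bounded continuous covector field.\<close>
    then have "adjoint_solution A g F f x \<omega> \<psi> S \<nu>"
      using assms(1) \<nu> N_deriv by (simp add: adjoint_solution_iff)
    moreover have "\<mu> = \<nu>" if "adjoint_solution A g F f x \<omega> \<psi> S \<mu>" for \<mu>
    proof
      fix \<tau>
      have "\<mu> \<tau> = N \<tau> o\<^sub>L Psi \<tau>" "\<nu> \<tau> = N \<tau> o\<^sub>L Psi \<tau>"
        using N[OF that] \<nu> by (simp_all only: eq_compose_Psi_iff)
      then show "\<mu> \<tau> = \<nu> \<tau>"
        by simp
    qed
    ultimately show "unique_adjoint_solution A g F f x \<omega> \<psi> S \<nu>"
      unfolding unique_adjoint_solution_def by blast
  qed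
qed

text \<open>The integrand in the difference of the two pairings is the derivative of \<open>-\<nu>(v)\<close> along the
  orbit, so its integral over \<open>[-T, T]\<close> stays bounded.\<close>
lemma expansion_imp_weak:
  assumes cov: "\<nu> \<in> covfields A g x" and "expansion_formula A F f Vs Vu x \<omega> \<psi> \<nu>"
  shows "weak_characterization A g F f x \<omega> \<psi> \<nu>"
  unfolding weak_characterization_def
proof (intro ballI)
  have \<nu>: "\<nu> t o\<^sub>L Phi t = N t" for t
    using assms(2) by (simp add: expansion_iff)
  have \<nu>_apply: "\<nu> t u = N t (Psi t u)" for t u
    by (simp flip: \<nu>)
  fix X p assume X: "X \<in> vfields A g x" and p_in: "p \<in> shadow_op A g F f x X"
  note p = shadow_opE[OF p_in shadowing_exists[OF X]]
  obtain v \<eta> where vp: "p = (v, \<eta>)"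
    by (cases p)
  have v: "v \<in> C1_vfields A g x" and \<eta>: "\<eta> \<in> funs"
    using p(1) by (auto simp: vp shadow_pairs_def)
  define w where "w t = Psi t (v t)" for t
  define Y where "Y t = Psi t (X t)" for t
  have Y_cont: "continuous_on UNIV Y"
    using X unfolding Y_def vfields_def by (intro transported_vfield_continuous) auto
  have w_cont: "continuous_on UNIV w"
    using v unfolding w_def C1_vfields_def vfields_def by (intro transported_vfield_continuous) auto
  have N_cont: "continuous_on UNIV N"
    using N_deriv by (intro continuous_at_imp_continuous_on ballI has_vector_derivative_continuous)
  have \<eta>_cont: "continuous_on UNIV \<eta>"
    using \<eta> by (simp add: funs_def)
  have \<psi>_cont: "continuous_on UNIV \<psi>"
    using \<psi>_deriv by (intro continuous_at_imp_continuous_on ballI has_vector_derivative_continuous)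
  have w_deriv: "(w has_vector_derivative Y t - \<eta> t *\<^sub>R F x0) (at t)" for t
  proof -
    have "w differentiable (at t)"
      using v unfolding w_def C1_vfields_def by (intro transported_C1_vfield_differentiable) auto
    then have d: "(w has_vector_derivative vector_derivative w (at t)) (at t)"
      by (simp add: vector_derivative_works)
    then have "lie_vec A f x v t = Phi t (vector_derivative w (at t))"
      unfolding w_def by (rule lie_vec_transported)
    then have "Phi t (vector_derivative w (at t)) + \<eta> t *\<^sub>R Phi t (F x0) = X t"
      using fun_cong[OF p(2), of t] by (simp add: vp perturbation_def Phi_F)
    then have "Psi t (Phi t (vector_derivative w (at t) + \<eta> t *\<^sub>R F x0)) = Y t"
      by (simp add: Y_def blinfun.add_right blinfun.scaleR_right)
    then have "vector_derivative w (at t) = Y t - \<eta> t *\<^sub>R F x0"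
      by (simp add: algebra_simps)
    with d show ?thesis
      by simp
  qed
  define h where "h t = N t (Y t) - (\<omega> t (v t) - \<eta> t * \<psi> t)" for t
  have om_v: "\<omega> t (v t) = om t (w t)" for t
    by (simp add: om_def w_def)
  have "((\<lambda>t. N t (w t)) has_vector_derivative N t (Y t - \<eta> t *\<^sub>R F x0) + (- om t) (w t)) (at t)" for t
    by (rule bounded_bilinear.has_vector_derivative[OF bounded_bilinear_blinfun_apply N_deriv w_deriv])
  \<comment> \<open>The normalization N(F) = -\<psi> turns the contribution of -\<eta> F into
    +\<eta> \<psi>, matching the second term of the product.\<close>
  moreover have "N t (Y t - \<eta> t *\<^sub>R F x0) + (- om t) (w t) = h t" for t
    by (simp add: h_def om_v blinfun.bilinear_simps N_apply)
  ultimately have h: "((\<lambda>t. N t (w t)) has_vector_derivative h t) (at t)" for t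
    by simp
  have c1: "continuous_on UNIV (\<lambda>t. \<omega> t (v t) - \<eta> t * \<psi> t)"
    unfolding om_v by (intro continuous_intros blinfun.continuous_on om_cont w_cont \<eta>_cont \<psi>_cont)
  have c2: "continuous_on UNIV (\<lambda>t. N t (Y t))"
    by (intro blinfun.continuous_on N_cont Y_cont)
  obtain B where B: "\<And>t u. \<bar>\<nu> t u\<bar> \<le> B * rnorm g (x t) u" "B \<ge> 0"
    by (rule covfield_bound[OF cov]) (assumption | rule that)+
  obtain D where D: "\<And>t. rnorm g (x t) (v t) \<le> D"
    using v unfolding C1_vfields_def vfields_def by blast
  \<comment> \<open>Transport preserves the pairing, so the bound is taken at \<open>x t\<close>,
    where \<nu> and \<open>v\<close> are bounded, although \<open>N\<close> and \<open>w\<close>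
    separately need not be.\<close>
  have bound: "\<bar>N t (w t)\<bar> \<le> B * D" for t
    using B(1)[of t "v t"] mult_left_mono[OF D[of t] B(2)] by (simp add: \<nu>_apply w_def)
  have diff: "shadow_product p \<omega> \<psi> T - 1 / (2 * T) * integral {- T..T} (\<lambda>t. \<nu> t (X t)) =
      (N (- T) (w (- T)) - N T (w T)) / (2 * T)" if "T > 0" for T
  proof -
    have "(h has_integral N T (w T) - N (- T) (w (- T))) {- T..T}"
      using that h by (intro fundamental_theorem_of_calculus) (auto intro: has_vector_derivative_at_within)
    then have "integral {- T..T} h = N T (w T) - N (- T) (w (- T))"
      by (rule integral_unique)
    moreover have "integral {- T..T} h = integral {- T..T} (\<lambda>t. N t (Y t)) -
        integral {- T..T} (\<lambda>t. \<omega> t (v t) - \<eta> t * \<psi> t)"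
      unfolding h_def
      by (intro integral_diff integrable_continuous_interval continuous_on_subset[OF c1]
          continuous_on_subset[OF c2]) auto
    ultimately have "integral {- T..T} (\<lambda>t. \<omega> t (v t) - \<eta> t * \<psi> t) - integral {- T..T} (\<lambda>t. N t (Y t)) =
        N (- T) (w (- T)) - N T (w T)"
      by linarith
    then show ?thesis
      by (simp add: shadow_product_def vp \<nu>_apply Y_def diff_divide_distrib[symmetric])
  qed
  have "\<bar>shadow_product p \<omega> \<psi> T - 1 / (2 * T) * integral {- T..T} (\<lambda>t. \<nu> t (X t))\<bar> \<le> B * D * (1 / T)"
    if "T > 0" for T
  proof -
    have "\<bar>N (- T) (w (- T)) - N T (w T)\<bar> \<le> 2 * (B * D)"
      using bound[of T] bound[of "- T"] by linarith
    then show ?thesis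
      using that unfolding diff[OF that] by (simp add: abs_divide divide_simps mult_ac)
  qed
  then have "\<forall>\<^sub>F T in at_top. norm (shadow_product p \<omega> \<psi> T -
      1 / (2 * T) * integral {- T..T} (\<lambda>t. \<nu> t (X t))) \<le> B * D * (1 / T)"
    by (auto intro: eventually_mono[OF eventually_gt_at_top[of 0]])
  moreover have "((\<lambda>T. B * D * (1 / T)) \<longlongrightarrow> 0) at_top"
    by (intro tendsto_mult_right_zero tendsto_divide_0[OF tendsto_const]
        filterlim_at_top_imp_at_infinity filterlim_ident)
  ultimately show "((\<lambda>T. shadow_product p \<omega> \<psi> T -
      1 / (2 * T) * integral {- T..T} (\<lambda>t. \<nu> t (X t))) \<longlongrightarrow> 0) at_top"
    by (rule Lim_null_comparison)
qed

end

theorem lemma8: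
  fixes A :: "('m::{t2_space,second_countable_topology}, 'e::euclidean_space) chart set"
    and g :: "'m \<Rightarrow> 'e \<Rightarrow> 'e \<Rightarrow> real"
    and F :: "'m \<Rightarrow> 'e" and f :: "real \<Rightarrow> 'm \<Rightarrow> 'm"
    and K :: "'m set" and Vs Vu :: "'m \<Rightarrow> 'e set"
    and x0 :: 'm and x :: "real \<Rightarrow> 'm"
    and \<omega> \<nu> :: "real \<Rightarrow> 'e \<Rightarrow>\<^sub>L real" and \<psi> :: "real \<Rightarrow> real"
  assumes "riemannian_manifold A g"
    and "smooth_vector_field A F"
    and "flow_of A F f"
    and "hyperbolic_attractor A g F f K Vs Vu"
    and "\<forall>p\<in>K. F p \<noteq> 0"
    and "x0 \<in> K"
    and "x = orbit f x0"
    and "(\<omega>, \<psi>) \<in> adjoint_pairs A g F x"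
    and "\<nu> \<in> covfields A g x"
  shows "(unique_adjoint_solution A g F f x \<omega> \<psi> UNIV \<nu> \<longleftrightarrow> expansion_formula A F f Vs Vu x \<omega> \<psi> \<nu>) \<and>
    (\<forall>\<tau>. unique_adjoint_solution A g F f x \<omega> \<psi> {\<tau>} \<nu> \<longleftrightarrow> expansion_formula A F f Vs Vu x \<omega> \<psi> \<nu>) \<and>
    (expansion_formula A F f Vs Vu x \<omega> \<psi> \<nu> \<longrightarrow> weak_characterization A g F f x \<omega> \<psi> \<nu>)"
proof -
  interpret adjoint_orbit A F f g x x0 K Vs Vu \<omega> \<psi>
    by unfold_locales (use assms in \<open>simp_all add: riemannian_manifold_def\<close>)
  show ?thesis
    using unique_solution_iff_expansion[OF assms(9)] expansion_imp_weak[OF assms(9)] by simp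
qed

end
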